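(* Let $s_1,s_2\in\mathbb{R}$, $0<p_1,p_2<\infty$, $0<q_1,q_2\le\infty$ and define $\alpha=p_1\big(\frac{s_2-s_1}{d}-\frac1{p_2}\big)+1$. For $\Gamma\subset\mathcal{D}$ (the dyadic cubes of $\mathbb{R}^d$) define $\nu_\alpha(\Gamma)=\sum_{Q\in\Gamma}|Q|^\alpha$. Let $\xi>0$ and $\mu\in(0,\infty]$. If $\alpha\ne1$, then $$\mathcal{A}^\xi_\mu(f^{s_1}_{p_1,q_1},\nu_\alpha)=\ell^{\tau,\mu}(\mathbf{u},\nu_\alpha)$$ (with equivalent quasi-norms), where $\frac1\tau=\xi+\frac1{p_1}$ and $\mathbf{u}=\{\|\mathbf{e}_Q\|_{f^{s_2}_{p_2,q_2}}\}_{Q\in\mathcal{D}}$. If $\alpha=1$, the same result holds provided $p_1=q_1$.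
   Context: $\mathcal{D}$ is the set of dyadic cubes $Q_{j,k}=2^{-j}([0,1)^d+k)$, $j\in\mathbb{Z}$, $k\in\mathbb{Z}^d$, of $\mathbb{R}^d$; $|Q|$ is the Lebesgue measure of $Q$; $S=\mathbb{C}^{\mathcal{D}}$; $\mathbf{e}_Q\in S$ has entry $1$ at $Q$ and $0$ elsewhere. For $\Gamma\subset\mathcal{D}$ (possibly infinite), $\sum_{Q\in\Gamma}t_Q\mathbf{e}_Q$ denotes the sequence with entry $t_Q$ for $Q\in\Gamma$ and $0$ otherwise. For $s\in\mathbb{R}$, $0<p<\infty$, $0<r\le\infty$, $f^s_{p,r}$ is the space of $\mathbf{s}=\{s_Q\}_{Q\in\mathcal{D}}\in S$ with $$\|\mathbf{s}\|_{f^s_{p,r}}=\Big\|\Big[\sum_{Q\in\mathcal{D}}\big(|Q|^{-s/d+1/r-1/2}|s_Q|\chi^{(r)}_Q(\cdot)\big)^r\Big]^{1/r}\Big\|_{L^p(\mathbb{R}^d)}<\infty,\qquad \chi^{(r)}_Q=\chi_Q|Q|^{-1/r}$$ (for $r=\infty$ the inner $\ell^r$ sum is a supremum, with $1/r=0$); the quasi-norm is $\infty$ for sequences not in the space. For a sequence space $f$ and a measure $\nu$ on $\mathcal{D}$: $\Sigma_{t,\nu}=\{\sum_{Q\in\Gamma}t_Q\mathbf{e}_Q:\nu(\Gamma)\le t\}$, $\sigma_\nu(t,\mathbf{s})=\inf_{\mathbf{t}\in\Sigma_{t,\nu}}\|\mathbf{s}-\mathbf{t}\|_f$ for $\mathbf{s}\in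 S$, and $\mathcal{A}^\xi_\mu(f,\nu)$ is the set of $\mathbf{s}\in S$ with $\|\mathbf{s}\|_{\mathcal{A}^\xi_\mu(f,\nu)}=\big(\int_0^\infty[t^\xi\sigma_\nu(t,\mathbf{s})]^\mu\frac{dt}{t}\big)^{1/\mu}<\infty$ (for $\mu=\infty$: $\sup_{t>0}t^\xi\sigma_\nu(t,\mathbf{s})<\infty$). For $\mathbf{s}\in S$, $\mathbf{s}^\ast_\nu(t)=\inf\{\lambda>0:\nu(\{Q:|s_Q|>\lambda\})\le t\}$. For $0<\tau<\infty$, $0<\mu\le\infty$ and a positive sequence $\mathbf{u}=\{u_Q\}$, $\ell^{\tau,\mu}(\mathbf{u},\nu)$ is the set of $\mathbf{s}\in S$ such that, with $\mathbf{d}=\{u_Qs_Q\}_{Q\in\mathcal{D}}$, $\|\mathbf{s}\|_{\ell^{\tau,\mu}(\mathbf{u},\nu)}=\big(\int_0^\infty[t^{1/\tau}\mathbf{d}^\ast_\nu(t)]^\mu\frac{dt}{t}\big)^{1/\mu}<\infty$ (for $\mu=\infty$: $\sup_{t>0}t^{1/\tau}\mathbf{d}^\ast_\nu(t)<\infty$). *)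

theory Defs
  imports "HOL-Analysis.Analysis"
begin

text \<open>
  The dyadic cube with index \<open>(j, k)\<close>, for an integer \<open>j\<close> and an integer vector \<open>k\<close>, is
  \<open>2\<^sup>-\<^sup>j([0,1)\<^sup>d + k)\<close>, where \<open>d = CARD('n)\<close>. Distinct indices give distinct cubes (lemma
  \<open>inj_dyadic_cube\<close> below), so families indexed by the set of dyadic cubes are represented as
  functions of the index, and subsets of the set of dyadic cubes as sets of indices.
\<close>

type_synonym 'n dyadic = "int \<times> (int, 'n) vec"

type_synonym 'n dyadic_seq = "'n dyadic \<Rightarrow> complex"

definition dyadic_cube :: "'n::finite dyadic \<Rightarrow> (real ^ 'n) set" where
  "dyadic_cube Q =
     (\<lambda>x. (2 powi (- fst Q)) *\<^sub>R (x + (\<chi> i. of_int (snd Q $ i)))) ` {x. \<forall>i. 0 \<le> x $ i \<and> x $ i < 1}"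

definition vol :: "'n::finite dyadic \<Rightarrow> real" where
  "vol Q = measure lborel (dyadic_cube Q)"

definition unit_seq :: "'n::finite dyadic \<Rightarrow> 'n dyadic_seq" where
  "unit_seq Q = (\<lambda>R. if R = Q then 1 else 0)"

text \<open>
  Powers of extended nonnegative numbers; only used with positive exponents, so that the power
  of infinity is infinity and the power of zero is zero.
\<close>

definition epowr :: "ennreal \<Rightarrow> real \<Rightarrow> ennreal" where
  "epowr x a = (if x = \<infinity> then \<infinity> else ennreal (enn2real x powr a))"

text \<open>
  Exponents in \<open>(0,\<infinity>]\<close> are extended nonnegative numbers; \<open>recip r\<close> is \<open>1/r\<close> with \<open>1/\<infinity> = 0\<close>.
\<close>

definition recip :: "ennreal \<Rightarrow> real" where
  "recip r = enn2real (inverse r)"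

definition chi_normalized :: "ennreal \<Rightarrow> 'n::finite dyadic \<Rightarrow> real ^ 'n \<Rightarrow> real" where
  "chi_normalized r Q x = indicator (dyadic_cube Q) x * vol Q powr (- recip r)"

definition f_term ::
    "real \<Rightarrow> ennreal \<Rightarrow> 'n::finite dyadic_seq \<Rightarrow> 'n dyadic \<Rightarrow> real ^ 'n \<Rightarrow> real" where
  "f_term s r a Q x =
     vol Q powr (- s / real CARD('n) + recip r - 1 / 2) * cmod (a Q) * chi_normalized r Q x"

definition f_inner ::
    "real \<Rightarrow> ennreal \<Rightarrow> 'n::finite dyadic_seq \<Rightarrow> real ^ 'n \<Rightarrow> ennreal" where
  "f_inner s r a x =
     (if r = \<infinity> then (SUP Q. ennreal (f_term s r a Q x))
      else epowr (\<integral>\<^sup>+ Q. ennreal (f_term s r a Q x powr enn2real r) \<partial>count_space UNIV) (recip r))"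

text \<open>The quasi-norm of \<open>f\<^sup>s\<^sub>p\<^sub>,\<^sub>r\<close>, with value infinity off the space.\<close>

definition f_norm :: "real \<Rightarrow> real \<Rightarrow> ennreal \<Rightarrow> 'n::finite dyadic_seq \<Rightarrow> ennreal" where
  "f_norm s p r a = epowr (\<integral>\<^sup>+ x. epowr (f_inner s r a x) p \<partial>lborel) (1 / p)"

text \<open>\<open>\<nu>\<^sub>\<alpha>(\<Gamma>)\<close> is the sum of \<open>|Q|\<^sup>\<alpha>\<close> over \<open>Q \<in> \<Gamma>\<close>, for every set \<open>\<Gamma>\<close> of dyadic cubes.\<close>

definition dyadic_measure :: "real \<Rightarrow> 'n::finite dyadic measure" where
  "dyadic_measure \<alpha> = point_measure UNIV (\<lambda>Q. ennreal (vol Q powr \<alpha>))"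

definition Sigma_set :: "'n::finite dyadic measure \<Rightarrow> real \<Rightarrow> 'n dyadic_seq set" where
  "Sigma_set \<nu> t = {(\<lambda>Q. if Q \<in> \<Gamma> then c Q else 0) | \<Gamma> c. emeasure \<nu> \<Gamma> \<le> ennreal t}"

definition approx_error ::
    "('n::finite dyadic_seq \<Rightarrow> ennreal) \<Rightarrow> 'n dyadic measure \<Rightarrow> real \<Rightarrow> 'n dyadic_seq \<Rightarrow> ennreal" where
  "approx_error N \<nu> t a = (INF b\<in>Sigma_set \<nu> t. N (\<lambda>Q. a Q - b Q))"

text \<open>The functional \<open>(\<integral>\<^sub>0\<^sup>\<infinity> [t\<^sup>\<kappa> \<phi>(t)]\<^sup>\<mu> dt/t)\<^sup>1\<^sup>/\<^sup>\<mu>\<close>, with the usual modification if \<open>\<mu> = \<infinity>\<close>.\<close>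

definition weighted_norm :: "real \<Rightarrow> ennreal \<Rightarrow> (real \<Rightarrow> ennreal) \<Rightarrow> ennreal" where
  "weighted_norm \<kappa> \<mu> \<phi> =
     (if \<mu> = \<infinity> then (SUP t\<in>{0<..}. ennreal (t powr \<kappa>) * \<phi> t)
      else epowr (\<integral>\<^sup>+ t\<in>{0<..}. epowr (ennreal (t powr \<kappa>) * \<phi> t) (enn2real \<mu>) * ennreal (1 / t) \<partial>lborel)
             (recip \<mu>))"

definition approx_norm ::
    "('n::finite dyadic_seq \<Rightarrow> ennreal) \<Rightarrow> 'n dyadic measure \<Rightarrow> real \<Rightarrow> ennreal \<Rightarrow> 'n dyadic_seq \<Rightarrow> ennreal"
  where "approx_norm N \<nu> \<xi> \<mu> a = weighted_norm \<xi> \<mu> (\<lambda>t. approx_error N \<nu> t a)"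

definition approx_space ::
    "('n::finite dyadic_seq \<Rightarrow> ennreal) \<Rightarrow> 'n dyadic measure \<Rightarrow> real \<Rightarrow> ennreal \<Rightarrow> 'n dyadic_seq set"
  where "approx_space N \<nu> \<xi> \<mu> = {a. approx_norm N \<nu> \<xi> \<mu> a < \<infinity>}"

definition rearrangement :: "'n::finite dyadic measure \<Rightarrow> 'n dyadic_seq \<Rightarrow> real \<Rightarrow> ennreal" where
  "rearrangement \<nu> a t =
     (INF l\<in>{l::real. 0 < l \<and> emeasure \<nu> {Q. cmod (a Q) > l} \<le> ennreal t}. ennreal l)"

definition lorentz_norm ::
    "real \<Rightarrow> ennreal \<Rightarrow> ('n::finite dyadic \<Rightarrow> real) \<Rightarrow> 'n dyadic measure \<Rightarrow> 'n dyadic_seq \<Rightarrow> ennreal" where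
  "lorentz_norm \<tau> \<mu> u \<nu> a =
     weighted_norm (1 / \<tau>) \<mu> (rearrangement \<nu> (\<lambda>Q. of_real (u Q) * a Q))"

definition lorentz_space ::
    "real \<Rightarrow> ennreal \<Rightarrow> ('n::finite dyadic \<Rightarrow> real) \<Rightarrow> 'n dyadic measure \<Rightarrow> 'n dyadic_seq set" where
  "lorentz_space \<tau> \<mu> u \<nu> = {a. lorentz_norm \<tau> \<mu> u \<nu> a < \<infinity>}"

text \<open>
  The weight \<open>u\<^sub>Q\<close> is the quasi-norm of \<open>unit_seq Q\<close>. This is a positive finite number, a power of
  the volume of the cube, so no information is lost by passing to a real number.
\<close>

definition unit_weight :: "real \<Rightarrow> real \<Rightarrow> ennreal \<Rightarrow> 'n::finite dyadic \<Rightarrow> real" where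
  "unit_weight s p r Q = enn2real (f_norm s p r (unit_seq Q))"

definition equivalent_on :: "'a set \<Rightarrow> ('a \<Rightarrow> ennreal) \<Rightarrow> ('a \<Rightarrow> ennreal) \<Rightarrow> bool" where
  "equivalent_on A N1 N2 \<longleftrightarrow>
     (\<exists>c C :: real. 0 < c \<and> 0 < C \<and>
        (\<forall>a\<in>A. ennreal c * N1 a \<le> N2 a \<and> N2 a \<le> ennreal C * N1 a))"

lemma mem_dyadic_cube_iff:
  fixes Q :: "'n::finite dyadic"
  shows "y \<in> dyadic_cube Q \<longleftrightarrow> (\<forall>i. \<lfloor>(2 powi (fst Q)) * y $ i\<rfloor> = snd Q $ i)"
proof
  assume "y \<in> dyadic_cube Q"
  then obtain x where x: "\<forall>i. 0 \<le> x $ i \<and> x $ i < 1"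
    and y: "y = (2 powi (- fst Q)) *\<^sub>R (x + (\<chi> i. of_int (snd Q $ i)))"
    by (auto simp: dyadic_cube_def)
  have "(2 powi (fst Q)) * y $ i = x $ i + of_int (snd Q $ i)" for i
    by (simp add: y power_int_minus)
  then show "\<forall>i. \<lfloor>(2 powi (fst Q)) * y $ i\<rfloor> = snd Q $ i"
    using x by (auto simp: floor_eq_iff)
next
  assume *: "\<forall>i. \<lfloor>(2 powi (fst Q)) * y $ i\<rfloor> = snd Q $ i"
  define x where "x = (\<chi> i. (2 powi (fst Q)) * y $ i - of_int (snd Q $ i))"
  have "0 \<le> x $ i \<and> x $ i < 1" for i
    using *[rule_format, of i] by (auto simp: x_def floor_eq_iff)
  moreover have "y = (2 powi (- fst Q)) *\<^sub>R (x + (\<chi> i. of_int (snd Q $ i)))"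
    by (simp add: vec_eq_iff x_def power_int_minus)
  ultimately show "y \<in> dyadic_cube Q"
    unfolding dyadic_cube_def by blast
qed

lemma inj_dyadic_cube: "inj (dyadic_cube :: 'n::finite dyadic \<Rightarrow> (real ^ 'n) set)"
proof (rule injI)
  fix Q R :: "'n dyadic"
  assume eq: "dyadic_cube Q = dyadic_cube R"
  have le: "fst R \<le> fst Q" if eq: "dyadic_cube Q = dyadic_cube R" for Q R :: "'n dyadic"
  proof (rule ccontr)
    assume "\<not> fst R \<le> fst Q"
    then have less: "fst Q + 1 \<le> fst R" by simp
    define a where "a = (2::real) powi (- fst Q)"
    define y where "y = (\<chi> i::'n. a * of_int (snd Q $ i))"
    define z where "z = (\<chi> i::'n. a * (of_int (snd Q $ i) + 1 / 2))"
    have a: "2 powi (fst Q) * a = 1"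
      by (simp add: a_def power_int_minus)
    have "2 powi (fst Q) * y $ i = of_int (snd Q $ i)" for i
      using a by (simp add: y_def flip: mult.assoc)
    then have "y \<in> dyadic_cube Q" by (simp add: mem_dyadic_cube_iff)
    moreover have "2 powi (fst Q) * z $ i = of_int (snd Q $ i) + 1 / 2" for i
      using a by (simp add: z_def flip: mult.assoc)
    then have "z \<in> dyadic_cube Q" by (simp add: mem_dyadic_cube_iff floor_eq_iff)
    ultimately have yz: "\<lfloor>2 powi (fst R) * y $ i\<rfloor> = \<lfloor>2 powi (fst R) * z $ i\<rfloor>" for i
      by (simp add: eq mem_dyadic_cube_iff)
    define i :: 'n where "i = undefined"
    have diff: "2 powi (fst R) * z $ i - 2 powi (fst R) * y $ i = 2 powi (fst R) * a / 2"
      by (simp add: y_def z_def algebra_simps)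
    have "(2::real) powi (fst Q + 1) * a \<le> 2 powi (fst R) * a"
      using less by (intro mult_right_mono power_int_increasing) (auto simp: a_def)
    moreover have "(2::real) powi (fst Q + 1) * a = 2"
      using a by (simp add: power_int_add)
    ultimately have "1 \<le> 2 powi (fst R) * a / 2" by simp
    then have "2 powi (fst R) * y $ i + 1 \<le> 2 powi (fst R) * z $ i"
      using diff by linarith
    then have "\<lfloor>2 powi (fst R) * y $ i + 1\<rfloor> \<le> \<lfloor>2 powi (fst R) * z $ i\<rfloor>"
      by (rule floor_mono)
    then show False using yz[of i] by simp
  qed
  have "fst Q = fst R"
    using le[OF eq] le[OF eq[symmetric]] by simp
  moreover have "snd Q = snd R"
  proof -
    define y where "y = (\<chi> i::'n. (2 powi (- fst Q)) * real_of_int (snd Q $ i))"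
    have "2 powi (fst Q) * y $ i = of_int (snd Q $ i)" for i
      by (simp add: y_def power_int_minus)
    then have "y \<in> dyadic_cube Q" "\<forall>i. \<lfloor>2 powi (fst Q) * y $ i\<rfloor> = snd Q $ i"
      by (simp_all add: mem_dyadic_cube_iff)
    with eq \<open>fst Q = fst R\<close> show ?thesis
      by (simp add: mem_dyadic_cube_iff vec_eq_iff)
  qed
  ultimately show "Q = R" by (rule prod_eqI)
qed

lemma emeasure_dyadic_measure:
  "emeasure (dyadic_measure \<alpha>) \<Gamma> = (\<integral>\<^sup>+ Q\<in>\<Gamma>. ennreal (vol Q powr \<alpha>) \<partial>count_space UNIV)"
  by (simp add: dyadic_measure_def point_measure_def emeasure_density)

end

theory Submission
  imports Defs
begin

text \<open>
  With \<open>w\<^sub>Q = u\<^sub>Q |a\<^sub>Q|\<close> and \<open>\<beta> = (\<alpha> - 1) / p\<^sub>1\<close>, the quasi-norm of \<open>a\<close> in \<open>f\<close> is the \<open>L\<^sup>p\<close> norm of the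
  \<open>\<ell>\<^sup>q\<close> norm of \<open>|Q|\<^sup>\<beta> w\<^sub>Q \<chi>\<^sub>Q\<close>, and \<open>\<nu>\<^sub>\<alpha>\<close> is \<open>\<Sum> |Q|\<^bsup>\<beta>p+1\<^esup>\<close>. The cubes containing a fixed point form
  a chain with one cube per scale, so for \<open>\<beta> \<noteq> 0\<close> sums of powers of \<open>|Q|\<^sup>\<beta>\<close> along subsets of the chain are
  comparable to their largest term, and the value of \<open>q\<close> is irrelevant; for \<open>\<beta> = 0\<close> and \<open>q = p\<close> the
  quasi-norm is that of \<open>\<ell>\<^sup>p(\<nu>)\<close>. This gives a weak-type lower bound \<open>\<lambda> \<nu>(w > \<lambda>)\<^bsup>1/p\<^esup> \<lesssim> \<parallel>w\<parallel>\<close> and an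
  interpolation upper bound \<open>\<parallel>w\<parallel> \<lesssim> (sup w)\<^sup>\<delta> (\<Sum> w\<^bsup>(1-\<delta>)p\<^esup> \<nu>)\<^bsup>1/p\<^esup>\<close>.

  Let \<open>w\<^sup>*\<close> be the decreasing rearrangement. Removing a set of measure at most \<open>t\<close> from a level set of
  measure greater than \<open>2t\<close> leaves measure at least \<open>t\<close>, so \<open>t\<^bsup>1/p\<^esup> w\<^sup>*(2t) \<lesssim> \<sigma>(t)\<close>. Removing the top level set and applying the
  upper bound to the rest gives \<open>\<sigma>(t) \<lesssim> t\<^bsup>1/p\<^esup> sup\<^sub>k 2\<^bsup>k(\<epsilon>+1/p)\<^esup> w\<^sup>*(2\<^sup>k t)\<close> for every \<open>\<epsilon> > 0\<close>. With
  \<open>\<epsilon> = \<xi>/2\<close>, dilation invariance of \<open>dt/t\<close> turns both pointwise estimates into the equivalence of quasi-norms.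
\<close>

section \<open>Powers of extended nonnegative numbers\<close>

lemma epowr_ennreal [simp]: "0 \<le> x \<Longrightarrow> epowr (ennreal x) a = ennreal (x powr a)"
  by (simp add: epowr_def)

lemma epowr_top [simp]: "epowr top a = top"
  by (simp add: epowr_def)

lemma epowr_mono:
  assumes "0 \<le> a" "x \<le> y"
  shows "epowr x a \<le> epowr y a"
  using assms by (cases x; cases y) (auto simp: top_unique intro!: powr_mono2 ennreal_leI)

lemma epowr_epowr: "epowr (epowr x a) b = epowr x (a * b)"
  by (cases x) (auto simp: powr_powr)

lemma epowr_zero [simp]: "epowr 0 a = 0"
  by (simp add: epowr_def)

lemma epowr_one [simp]: "epowr x 1 = x"
  by (cases x) auto

lemma epowr_mult: "epowr (x * y) a = epowr x a * epowr y a"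
proof -
  \<comment> \<open>The conventions \<open>0 * top = 0\<close> and \<open>epowr 0 a = 0\<close>
    agree, so the identity with an infinite factor survives at \<open>z = 0\<close>.\<close>
  have top_left: "epowr (top * z) a = top * epowr z a" for z
    by (cases z) (auto simp: ennreal_top_mult)
  show ?thesis
  proof (cases x)
    case (real r)
    show ?thesis
    proof (cases y)
      case (real s)
      then show ?thesis
        using \<open>0 \<le> r\<close> \<open>x = ennreal r\<close> by (simp add: powr_mult flip: ennreal_mult)
    next
      case top
      then show ?thesis using top_left[of x] by (simp add: mult.commute)
    qed
  next
    case top
    then show ?thesis using top_left[of y] by simp
  qed
qed

lemma measurable_epowr [measurable]: "(\<lambda>x. epowr x a) \<in> borel_measurable borel"
  unfolding epowr_def by measurable

section \<open>Dyadic cubes and chains\<close>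

text \<open>The half-open cube lies between an open and a closed box with the same corners. These
  have equal Lebesgue measure, so the volume is \<open>h ^ d\<close> with edge length
  \<open>h = 2 powi (- j)\<close>.\<close>

lemma vol_eq_powr:
  fixes Q :: "'n::finite dyadic"
  shows "vol Q = 2 powr (- real CARD('n) * of_int (fst Q))"
    and emeasure_dyadic_cube: "emeasure lborel (dyadic_cube Q) = ennreal (vol Q)"
    and sets_dyadic_cube [measurable]: "dyadic_cube Q \<in> sets borel"
proof -
  define h where "h = (2::real) powi (- fst Q)"
  have h: "0 < h" by (simp add: h_def)
  define a where "a = (\<chi> i. h * of_int (snd Q $ i))"
  define b where "b = (\<chi> i. h * (of_int (snd Q $ i) + 1))"
  have mem: "y \<in> dyadic_cube Q \<longleftrightarrow> (\<forall>i. a $ i \<le> y $ i \<and> y $ i < b $ i)" for y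
  proof -
    have "2 powi (fst Q) * y $ i = y $ i / h" for i
      by (simp add: h_def power_int_minus field_simps)
    then have "y \<in> dyadic_cube Q \<longleftrightarrow> (\<forall>i. of_int (snd Q $ i) \<le> y $ i / h \<and> y $ i / h < of_int (snd Q $ i) + 1)"
      by (simp add: mem_dyadic_cube_iff floor_eq_iff)
    then show ?thesis
      using h by (simp add: a_def b_def pos_le_divide_eq pos_divide_less_eq mult.commute)
  qed
  show meas: "dyadic_cube Q \<in> sets borel"
  proof -
    have "dyadic_cube Q = {y \<in> space borel. \<forall>i. a $ i \<le> y $ i \<and> y $ i < b $ i}"
      using mem by auto
    also have "\<dots> \<in> sets borel" by measurable
    finally show ?thesis .
  qed
  have ab: "a $ i \<le> b $ i" for i using h by (simp add: a_def b_def)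
  then have ab': "a \<bullet> c \<le> b \<bullet> c" if "c \<in> Basis" for c
    using that by (auto simp: Basis_vec_def inner_axis)
  have ne: "cbox a b \<noteq> {}" using ab by (simp add: interval_ne_empty_cart)
  have "measure lborel (cbox a b) = h ^ CARD('n)"
    using ne by (simp add: content_cbox_cart a_def b_def algebra_simps)
  then have cbox: "emeasure lborel (cbox a b) = ennreal (h ^ CARD('n))"
    by (metis emeasure_eq_ennreal_measure emeasure_lborel_cbox_finite infinity_ennreal_def less_irrefl)
  have box: "emeasure lborel (box a b) = emeasure lborel (cbox a b)"
    using ab' by simp
  have "emeasure lborel (box a b) \<le> emeasure lborel (dyadic_cube Q)"
    using meas by (intro emeasure_mono) (auto simp: mem mem_box_cart less_imp_le)
  moreover have "emeasure lborel (dyadic_cube Q) \<le> emeasure lborel (cbox a b)"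
    by (intro emeasure_mono) (auto simp: mem mem_box_cart less_imp_le)
  ultimately have em: "emeasure lborel (dyadic_cube Q) = ennreal (h ^ CARD('n))"
    using box cbox by simp
  then have v: "vol Q = h ^ CARD('n)"
    using h by (simp add: vol_def measure_def)
  then show "emeasure lborel (dyadic_cube Q) = ennreal (vol Q)"
    using em by simp
  have "h = 2 powr (- of_int (fst Q))"
    using powr_real_of_int'[of 2 "- fst Q"] by (simp add: h_def)
  then show "vol Q = 2 powr (- real CARD('n) * of_int (fst Q))"
    using v by (simp add: powr_powr mult.commute flip: powr_realpow)
qed

lemma vol_pos [simp]: "0 < vol (Q :: 'n::finite dyadic)"
  by (simp add: vol_eq_powr)

section \<open>Sums along the chain of cubes through a point\<close>

lemma dyadic_cube_unique:
  assumes "x \<in> dyadic_cube Q" "x \<in> dyadic_cube R" "fst Q = fst R"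
  shows "Q = R"
  using assms by (intro prod_eqI) (auto simp: mem_dyadic_cube_iff vec_eq_iff)

text \<open>The index set is split into the fibres of \<open>K\<close> and a geometric series is
  summed. The fibres are scales of cubes in one application and levels of a function in the
  others.\<close>

lemma nn_integral_le_geometric:
  fixes F :: "'i::countable \<Rightarrow> ennreal" and K :: "'i \<Rightarrow> nat"
  assumes le: "\<And>k. (\<integral>\<^sup>+ i. F i * indicator {i. K i = k} i \<partial>count_space UNIV) \<le> ennreal (c * r ^ k)"
    and "0 \<le> c" "0 \<le> r" "r < 1"
  shows "(\<integral>\<^sup>+ i. F i \<partial>count_space UNIV) \<le> ennreal (c / (1 - r))"
proof -
  have "F i = (\<Sum>k. F i * indicator {i. K i = k} i)" for i
    using suminf_finite[of "{K i}" "\<lambda>k. F i * indicator {i. K i = k} i"]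
    by (simp add: indicator_def)
  then have "(\<integral>\<^sup>+ i. F i \<partial>count_space UNIV)
      = (\<integral>\<^sup>+ i. (\<Sum>k. F i * indicator {i. K i = k} i) \<partial>count_space UNIV)"
    by simp
  also have "\<dots> = (\<Sum>k. \<integral>\<^sup>+ i. F i * indicator {i. K i = k} i \<partial>count_space UNIV)"
    by (rule nn_integral_suminf) simp
  also have "\<dots> \<le> (\<Sum>k. ennreal (c * r ^ k))"
    by (intro suminf_le le) auto
  also have "\<dots> = ennreal (c / (1 - r))"
    using assms geometric_sums[of r] sums_mult[of "\<lambda>k. r ^ k" "1 / (1 - r)" c]
    by (intro suminf_ennreal_eq) auto
  finally show ?thesis .
qed

lemma nn_integral_at_most_one_point:
  assumes "\<And>i j. i \<in> S \<Longrightarrow> j \<in> S \<Longrightarrow> i = j" "\<And>i. i \<in> S \<Longrightarrow> F i \<le> b"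
  shows "(\<integral>\<^sup>+ i. F i * indicator S i \<partial>count_space UNIV) \<le> (b :: ennreal)"
proof (cases "S = {}")
  case False
  then obtain i where S: "S = {i}" using assms(1) by blast
  have "(\<integral>\<^sup>+ i. F i * indicator S i \<partial>count_space UNIV) = F i"
    by (simp add: S nn_integral_indicator_finite flip: nn_integral_count_space_indicator)
  then show ?thesis using assms(2)[of i] S by simp
qed simp

text \<open>The cubes through \<open>x\<close> have pairwise different scales, and
  \<open>|Q|^\<gamma>\<close> is geometric in the scale. Hence a sum over any subset of the chain is
  dominated by a geometric series with first term at most \<open>B\<close>. The sign of
  \<open>\<gamma>\<close> only decides whether the small or the large cubes carry the sum; working
  with \<open>\<bar>g\<bar>\<close> treats both. The constant depends on neither \<open>x\<close>,
  \<open>B\<close> nor \<open>S\<close>.\<close>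

lemma dyadic_chain_sum_le:
  fixes \<gamma> :: real
  assumes "\<gamma> \<noteq> 0"
  obtains C where "0 < C"
    "\<And>(x :: real ^ 'n::finite) B S. 0 \<le> B \<Longrightarrow> (\<And>Q. Q \<in> S \<Longrightarrow> x \<in> dyadic_cube Q \<and> vol Q powr \<gamma> \<le> B) \<Longrightarrow>
       (\<integral>\<^sup>+ Q. ennreal (vol Q powr \<gamma>) * indicator S Q \<partial>count_space UNIV) \<le> ennreal (C * B)"
proof -
  define g where "g = - real CARD('n) * \<gamma>"
  have g: "g \<noteq> 0" using assms by (simp add: g_def)
  have vol: "vol Q powr \<gamma> = 2 powr (g * of_int (fst Q))" for Q :: "'n dyadic"
    by (simp add: vol_eq_powr powr_powr g_def mult_ac)
  define r where "r = 2 powr (- \<bar>g\<bar>)"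
  have r: "0 < r" "r < 1"
    using g by (auto simp: r_def powr_less_one)
  show ?thesis
  proof
    show "0 < 1 / (1 - r)" using r by simp
    fix x :: "real ^ 'n" and B :: real and S
    assume B: "0 \<le> B" and S: "\<And>Q. Q \<in> S \<Longrightarrow> x \<in> dyadic_cube Q \<and> vol Q powr \<gamma> \<le> B"
    show "(\<integral>\<^sup>+ Q. ennreal (vol Q powr \<gamma>) * indicator S Q \<partial>count_space UNIV) \<le> ennreal (1 / (1 - r) * B)"
    proof (cases "B = 0")
      case True
      then have "S = {}" using S vol by (force simp: not_le[symmetric])
      then show ?thesis by simp
    next
      case False
      define b where "b = log 2 B"
      have Bb: "B = 2 powr b" using B False by (simp add: b_def)
      \<comment> \<open>\<open>K\<close> enumerates the cubes of \<open>S\<close> by decreasing \<open>|Q|\<^sup>\<gamma>\<close>, which lies in \<open>(B r\<^bsup>K Q + 1\<^esup>, B r\<^bsup>K Q\<^esup>]\<close>.\<close>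
      define K where "K Q = nat \<lfloor>(b - g * of_int (fst Q)) / \<bar>g\<bar>\<rfloor>" for Q :: "'n dyadic"
      have le: "g * of_int (fst Q) \<le> b" if "Q \<in> S" for Q
        using S[OF that] by (simp add: vol Bb)
      have Kle: "real (K Q) \<le> (b - g * of_int (fst Q)) / \<bar>g\<bar>" if "Q \<in> S" for Q
        using le[OF that] g by (simp add: K_def)
      have inj: "Q = R" if "Q \<in> S" "R \<in> S" "K Q = K R" for Q R
      proof -
        have nn: "0 \<le> \<lfloor>(b - g * of_int (fst Q)) / \<bar>g\<bar>\<rfloor>" "0 \<le> \<lfloor>(b - g * of_int (fst R)) / \<bar>g\<bar>\<rfloor>"
          using le that g by simp_all
        then have eq: "\<lfloor>(b - g * of_int (fst Q)) / \<bar>g\<bar>\<rfloor> = \<lfloor>(b - g * of_int (fst R)) / \<bar>g\<bar>\<rfloor>"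
          using that(3) unfolding K_def by (simp only: eq_nat_nat_iff)
        \<comment> \<open>The argument of the floor is a constant plus or minus the integer scale,
          so equal floors force equal scales.\<close>
        have "fst Q = fst R"
        proof (cases "0 < g")
          case True
          have "(b - g * of_int j) / \<bar>g\<bar> = b / g - of_int j" for j :: int
            using True by (simp add: field_simps)
          then show ?thesis using eq by simp
        next
          case False
          have "(b - g * of_int j) / \<bar>g\<bar> = of_int j + b / \<bar>g\<bar>" for j :: int
            using False g by (simp add: field_simps)
          then show ?thesis using eq by simp
        qed
        then show ?thesis using S that dyadic_cube_unique by blast
      qed
      have tm: "vol Q powr \<gamma> \<le> B * r ^ K Q" if "Q \<in> S" for Q
      proof -
        have "g * of_int (fst Q) \<le> b - \<bar>g\<bar> * real (K Q)"
          using Kle[OF that] g by (simp add: field_simps)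
        then have "vol Q powr \<gamma> \<le> 2 powr (b - \<bar>g\<bar> * real (K Q))"
          by (simp add: vol)
        also have "\<dots> = B * r ^ K Q"
        proof -
          have "r ^ K Q = 2 powr (- (\<bar>g\<bar> * real (K Q)))"
            unfolding r_def by (simp add: powr_power mult.commute)
          then show ?thesis
            by (simp add: Bb flip: powr_add)
        qed
        finally show ?thesis .
      qed
      have "(\<integral>\<^sup>+ Q. ennreal (vol Q powr \<gamma>) * indicator S Q \<partial>count_space UNIV) \<le> ennreal (B / (1 - r))"
      proof (rule nn_integral_le_geometric[where K = K])
        fix k
        have "(\<integral>\<^sup>+ Q. ennreal (vol Q powr \<gamma>) * indicator S Q * indicator {i. K i = k} Q \<partial>count_space UNIV)
          = (\<integral>\<^sup>+ Q. ennreal (vol Q powr \<gamma>) * indicator (S \<inter> {i. K i = k}) Q \<partial>count_space UNIV)"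
          by (intro nn_integral_cong) (auto split: split_indicator)
        also have "\<dots> \<le> ennreal (B * r ^ k)"
          using inj tm by (intro nn_integral_at_most_one_point) (auto intro!: ennreal_leI)
        finally show "(\<integral>\<^sup>+ Q. ennreal (vol Q powr \<gamma>) * indicator S Q * indicator {i. K i = k} Q \<partial>count_space UNIV)
           \<le> ennreal (B * r ^ k)" .
      qed (use B r in auto)
      then show ?thesis by simp
    qed
  qed
qed

section \<open>Geometric levels of a bounded function and interpolation on chains\<close>

lemma geometric_level:
  fixes b w M :: real
  assumes "1 < b" "0 < w" "w \<le> M"
  obtains k :: nat where "M / b ^ Suc k < w" "w \<le> M / b ^ k"
proof -
  obtain n where "M / w < b ^ n" using real_arch_pow[OF assms(1)] by blast
  then have ex: "M / b ^ n < w" using assms by (simp add: pos_divide_less_eq mult.commute)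
  define m where "m = (LEAST n. M / b ^ n < w)"
  have m: "M / b ^ m < w" unfolding m_def by (rule LeastI[of _ n]) (rule ex)
  then have "m \<noteq> 0" using assms(3) by (intro notI) simp
  then obtain k where k: "m = Suc k" by (cases m) auto
  then have "\<not> M / b ^ k < w"
    using not_less_Least[of k "\<lambda>n. M / b ^ n < w"] by (simp add: m_def)
  then show thesis using that[of k] m k by simp
qed

text \<open>Points where \<open>w\<close> is not positive lie on no level and leave \<open>K\<close>
  unconstrained; in the applications \<open>w\<close> vanishes there, so they contribute nothing to
  the sums.\<close>

lemma geometric_levels:
  fixes w :: "'i \<Rightarrow> real"
  assumes "1 < b" "\<And>i. w i \<le> M"
  shows "\<exists>K. \<forall>i. 0 < w i \<longrightarrow> M / b ^ Suc (K i) < w i \<and> w i \<le> M / b ^ K i"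
proof (rule choice, rule allI)
  show "\<exists>k. 0 < w i \<longrightarrow> M / b ^ Suc k < w i \<and> w i \<le> M / b ^ k" for i
  proof (cases "0 < w i")
    case True
    obtain k where "M / b ^ Suc k < w i" "w i \<le> M / b ^ k"
      by (rule geometric_level[OF assms(1) True assms(2)])
    then show ?thesis by blast
  qed simp
qed

text \<open>The chain is split by the dyadic levels of \<open>w\<close>. Where \<open>w\<close> is
  about \<open>M / 2^k\<close>, the hypothesis on \<open>T\<close> bounds \<open>|Q|^\<beta>\<close>
  by about \<open>T * (M / 2^k) powr (\<delta> - 1)\<close>. The chain estimate then bounds the
  level by a multiple of \<open>(T * (M / 2^k) powr \<delta>) powr q\<close>. The remaining power
  \<open>\<delta>\<close> of the level gives geometric decay in \<open>k\<close>.\<close>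

lemma chain_sum_interpolation:
  fixes \<beta> q \<delta> :: real
  assumes "\<beta> \<noteq> 0" "0 < q" "0 < \<delta>" "\<delta> < 1"
  obtains C where "0 < C"
    "\<And>(x :: real ^ 'n::finite) w M T. 0 < M \<Longrightarrow> 0 \<le> T \<Longrightarrow> (\<And>Q. 0 \<le> w Q) \<Longrightarrow> (\<And>Q. w Q \<le> M) \<Longrightarrow>
       (\<And>Q. x \<in> dyadic_cube Q \<Longrightarrow> vol Q powr \<beta> * w Q powr (1 - \<delta>) \<le> T) \<Longrightarrow>
       (\<integral>\<^sup>+ Q. ennreal ((vol Q powr \<beta> * w Q * indicator (dyadic_cube Q) x) powr q) \<partial>count_space UNIV)
         \<le> ennreal (C * (T * M powr \<delta>) powr q)"
proof -
  have ne: "\<beta> * q \<noteq> 0" using assms by simp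
  show ?thesis
  proof (rule dyadic_chain_sum_le[OF ne, where 'n = 'n])
    fix C0 assume C0: "0 < C0" and
      chain: "\<And>(x :: real ^ 'n) B S. 0 \<le> B \<Longrightarrow> (\<And>Q. Q \<in> S \<Longrightarrow> x \<in> dyadic_cube Q \<and> vol Q powr (\<beta> * q) \<le> B) \<Longrightarrow>
         (\<integral>\<^sup>+ Q. ennreal (vol Q powr (\<beta> * q)) * indicator S Q \<partial>count_space UNIV) \<le> ennreal (C0 * B)"
    define r where "r = 2 powr (- \<delta> * q)"
    have r: "0 < r" "r < 1" using assms by (auto simp: r_def powr_less_one)
    show ?thesis
    proof
      show "0 < C0 * 2 powr ((1 - \<delta>) * q) / (1 - r)" using C0 r by simp
      fix x :: "real ^ 'n" and w and M T :: real
      assume M: "0 < M" and T: "0 \<le> T" and w0: "\<And>Q. 0 \<le> w Q" and wM: "\<And>Q. w Q \<le> M"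
        and wT: "\<And>Q. x \<in> dyadic_cube Q \<Longrightarrow> vol Q powr \<beta> * w Q powr (1 - \<delta>) \<le> T"
      have "\<exists>K. \<forall>Q. 0 < w Q \<longrightarrow> M / 2 ^ Suc (K Q) < w Q \<and> w Q \<le> M / 2 ^ K Q"
        by (rule geometric_levels) (simp_all add: wM)
      then obtain K where "\<forall>Q. 0 < w Q \<longrightarrow> M / 2 ^ Suc (K Q) < w Q \<and> w Q \<le> M / 2 ^ K Q" ..
      then have K: "\<And>Q. 0 < w Q \<Longrightarrow> M / 2 ^ Suc (K Q) < w Q" "\<And>Q. 0 < w Q \<Longrightarrow> w Q \<le> M / 2 ^ K Q"
        by blast+
      let ?F = "\<lambda>Q. ennreal ((vol Q powr \<beta> * w Q * indicator (dyadic_cube Q) x) powr q)"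
      have "(\<integral>\<^sup>+ Q. ?F Q \<partial>count_space UNIV)
          \<le> ennreal ((C0 * 2 powr ((1 - \<delta>) * q) * (T * M powr \<delta>) powr q) / (1 - r))"
      proof (rule nn_integral_le_geometric[where K = K])
        fix k
        \<comment> \<open>On level \<open>k\<close> positive values of \<open>w\<close> lie in the
          interval from \<open>A / 2\<close> to \<open>A\<close>. The lower end yields the bound
          \<open>B\<close> on the cubes, the upper end bounds the factor
          \<open>w powr q\<close>.\<close>
        define A where "A = M / 2 ^ k"
        have A: "0 < A" using M by (simp add: A_def)
        define B where "B = (T * (A / 2) powr (- (1 - \<delta>))) powr q"
        define S where "S = {Q. K Q = k \<and> 0 < w Q \<and> x \<in> dyadic_cube Q}"
        have volB: "vol Q powr (\<beta> * q) \<le> B" if "Q \<in> S" for Q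
        proof -
          have Q: "K Q = k" "0 < w Q" "x \<in> dyadic_cube Q" using that by (auto simp: S_def)
          have "(A / 2) powr (1 - \<delta>) \<le> w Q powr (1 - \<delta>)"
            using K(1)[OF Q(2)] Q(1) A assms by (intro powr_mono2) (auto simp: A_def field_simps)
          then have "vol Q powr \<beta> * (A / 2) powr (1 - \<delta>) \<le> vol Q powr \<beta> * w Q powr (1 - \<delta>)"
            by (intro mult_left_mono) auto
          also have "\<dots> \<le> T" by (rule wT[OF Q(3)])
          finally have "vol Q powr \<beta> \<le> T * (A / 2) powr (- (1 - \<delta>))"
            using A by (simp only: powr_minus_divide) (simp add: pos_le_divide_eq)
          then have "(vol Q powr \<beta>) powr q \<le> B"
            unfolding B_def using assms by (intro powr_mono2) auto
          then show ?thesis by (simp add: powr_powr)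
        qed
        have "(\<integral>\<^sup>+ Q. ?F Q * indicator {Q. K Q = k} Q \<partial>count_space UNIV)
            \<le> (\<integral>\<^sup>+ Q. ennreal (A powr q) * (ennreal (vol Q powr (\<beta> * q)) * indicator S Q) \<partial>count_space UNIV)"
        proof (rule nn_integral_mono)
          fix Q :: "'n dyadic"
          show "?F Q * indicator {Q. K Q = k} Q \<le> ennreal (A powr q) * (ennreal (vol Q powr (\<beta> * q)) * indicator S Q)"
          proof (cases "Q \<in> S")
            case True
            then have Q: "K Q = k" "0 < w Q" "x \<in> dyadic_cube Q" by (auto simp: S_def)
            have "w Q powr q \<le> A powr q"
              using K(2)[OF Q(2)] Q(1,2) assms by (intro powr_mono2) (auto simp: A_def)
            then have "vol Q powr (\<beta> * q) * w Q powr q \<le> A powr q * vol Q powr (\<beta> * q)"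
              by (subst mult.commute) (rule mult_right_mono, simp_all)
            then show ?thesis
              using Q True w0 by (simp add: powr_mult powr_powr ennreal_leI flip: ennreal_mult)
          next
            case False
            then have "K Q \<noteq> k \<or> w Q = 0 \<or> x \<notin> dyadic_cube Q"
              using w0[of Q] by (auto simp: S_def)
            then show ?thesis using assms(2) by auto
          qed
        qed
        also have "\<dots> = ennreal (A powr q) * (\<integral>\<^sup>+ Q. ennreal (vol Q powr (\<beta> * q)) * indicator S Q \<partial>count_space UNIV)"
          by (rule nn_integral_cmult) simp
        also have "\<dots> \<le> ennreal (A powr q) * ennreal (C0 * B)"
          using volB by (intro mult_left_mono chain[where x = x]) (auto simp: B_def S_def)
        also have "\<dots> = ennreal (A powr q * (C0 * B))"
          using C0 by (simp add: B_def flip: ennreal_mult)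
        \<comment> \<open>The powers \<open>A\<close> and \<open>A powr (\<delta> - 1)\<close>
          combine to \<open>A powr \<delta>\<close>, which is \<open>M powr \<delta>\<close> times
          \<open>2 powr (- \<delta> * k)\<close>; its \<open>q\<close>-th power supplies
          \<open>r ^ k\<close>.\<close>
        also have "A powr q * (C0 * B) = C0 * 2 powr ((1 - \<delta>) * q) * (T * M powr \<delta>) powr q * r ^ k"
        proof -
          have "A * (A / 2) powr (- (1 - \<delta>)) = 2 powr (1 - \<delta>) * A powr \<delta>"
          proof -
            have "(A / 2) powr (\<delta> - 1) = A powr (\<delta> - 1) * 2 powr (1 - \<delta>)"
              using powr_minus_divide[of 2 "\<delta> - 1"] by (simp add: powr_divide)
            moreover have "A * A powr (\<delta> - 1) = A powr \<delta>"
              using A powr_mult_base[of A "\<delta> - 1"] by simp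
            ultimately show ?thesis by simp
          qed
          moreover have "A powr \<delta> = M powr \<delta> * (2 powr (- \<delta>)) ^ k"
          proof -
            have "A = M * 2 powr (- real k)"
              by (simp add: A_def powr_minus powr_realpow divide_inverse)
            then have "A powr \<delta> = M powr \<delta> * 2 powr (- real k * \<delta>)"
              using M by (simp only: powr_mult powr_powr)
            also have "2 powr (- real k * \<delta>) = (2 powr (- \<delta>)) ^ k"
              by (simp add: powr_power)
            finally show ?thesis .
          qed
          ultimately have "A * (T * (A / 2) powr (- (1 - \<delta>))) = 2 powr (1 - \<delta>) * (T * M powr \<delta>) * (2 powr (- \<delta>)) ^ k"
            by (simp add: mult_ac)
          then have "(A * (T * (A / 2) powr (- (1 - \<delta>)))) powr q
              = (2 powr (1 - \<delta>) * (T * M powr \<delta>) * (2 powr (- \<delta>)) ^ k) powr q"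
            by (rule arg_cong)
          also have "\<dots> = 2 powr ((1 - \<delta>) * q) * (T * M powr \<delta>) powr q * ((2 powr (- \<delta>)) ^ k) powr q"
            by (simp only: powr_mult powr_powr)
          also have "((2 powr (- \<delta>)) ^ k) powr q = r ^ k"
            unfolding r_def by (simp add: powr_power powr_powr mult.assoc)
          finally have "A powr q * B = 2 powr ((1 - \<delta>) * q) * (T * M powr \<delta>) powr q * r ^ k"
            unfolding B_def by (simp only: powr_mult)
          then show ?thesis by simp
        qed
        finally show "(\<integral>\<^sup>+ Q. ?F Q * indicator {Q. K Q = k} Q \<partial>count_space UNIV)
            \<le> ennreal (C0 * 2 powr ((1 - \<delta>) * q) * (T * M powr \<delta>) powr q * r ^ k)" .
      qed (use C0 r in auto)
      then show "(\<integral>\<^sup>+ Q. ?F Q \<partial>count_space UNIV)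
          \<le> ennreal (C0 * 2 powr ((1 - \<delta>) * q) / (1 - r) * (T * M powr \<delta>) powr q)"
        by simp
    qed
  qed
qed

section \<open>Pointwise bounds\<close>

text \<open>The \<open>\<ell>^r\<close> quasi-norm of a nonnegative family, separated from the
  function space so that it can be estimated at a fixed point.\<close>

definition lq :: "ennreal \<Rightarrow> ('i \<Rightarrow> real) \<Rightarrow> ennreal" where
  "lq r v = (if r = \<infinity> then (SUP i. ennreal (v i))
     else epowr (\<integral>\<^sup>+ i. ennreal (v i powr enn2real r) \<partial>count_space UNIV) (recip r))"

lemma recip_ennreal: "0 < r \<Longrightarrow> recip (ennreal r) = 1 / r"
  by (simp add: recip_def inverse_ennreal divide_inverse)

lemma ennreal_exponent_cases:
  fixes r :: ennreal
  assumes "0 < r"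
  obtains (top) "r = top" | (real) r' where "r = ennreal r'" "0 < r'"
  using assms by (cases r) auto

lemma lq_ge:
  assumes "0 < r" "0 \<le> v i"
  shows "ennreal (v i) \<le> lq r v"
  using assms(1)
proof (cases r rule: ennreal_exponent_cases)
  case top
  then show ?thesis by (auto simp: lq_def intro: SUP_upper)
next
  case (real r')
  have "epowr (ennreal (v i powr r')) (1 / r')
      \<le> epowr (\<integral>\<^sup>+ i. ennreal (v i powr r') \<partial>count_space UNIV) (1 / r')"
    using real by (intro epowr_mono nn_integral_ge_point) auto
  then show ?thesis
    using real assms by (simp add: lq_def recip_ennreal powr_powr)
qed

lemma epowr_lq_same:
  assumes "0 < p"
  shows "epowr (lq (ennreal p) v) p = (\<integral>\<^sup>+ i. ennreal (v i powr p) \<partial>count_space UNIV)"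
  using assms by (simp add: lq_def recip_ennreal epowr_epowr)

text \<open>If the quasi-norm at \<open>x\<close> has the finite value \<open>L\<close>, each term
  is at most \<open>L\<close>, so every cube of \<open>A\<close> containing \<open>x\<close>
  satisfies \<open>|Q|^\<beta> \<le> L / l\<close>. For \<open>\<beta> \<noteq> 0\<close> the chain
  estimate with exponent \<open>\<beta> * p\<close> sums these cubes, and only the largest term
  matters, whatever \<open>q\<close> is. For \<open>\<beta> = 0\<close> the exponents coincide and
  the terms are compared one by one.\<close>

lemma lq_cubes_lower:
  fixes \<beta> p :: real
  assumes p: "0 < p" and q: "0 < q" and \<beta>: "\<beta> = 0 \<Longrightarrow> q = ennreal p"
  obtains c where "0 < c"
    "\<And>(x :: real ^ 'n::finite) w l A. 0 < l \<Longrightarrow> (\<And>Q. 0 \<le> w Q) \<Longrightarrow> (\<And>Q. Q \<in> A \<Longrightarrow> l < w Q) \<Longrightarrow>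
       ennreal (c * l powr p) *
         (\<integral>\<^sup>+ Q. ennreal (vol Q powr (\<beta> * p) * indicator (dyadic_cube Q) x) * indicator A Q \<partial>count_space UNIV)
       \<le> epowr (lq q (\<lambda>Q. vol Q powr \<beta> * w Q * indicator (dyadic_cube Q) x)) p"
proof (cases "\<beta> = 0")
  case True
  show ?thesis
  proof
    fix x :: "real ^ 'n" and w :: "'n dyadic \<Rightarrow> real" and l :: real and A :: "'n dyadic set"
    assume l: "0 < l" and w0: "\<And>Q. 0 \<le> w Q" and wl: "\<And>Q. Q \<in> A \<Longrightarrow> l < w Q"
    have "ennreal (1 * l powr p) *
         (\<integral>\<^sup>+ Q. ennreal (vol Q powr (\<beta> * p) * indicator (dyadic_cube Q) x) * indicator A Q \<partial>count_space UNIV)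
       = (\<integral>\<^sup>+ Q. ennreal (l powr p) * (ennreal (vol Q powr (\<beta> * p) * indicator (dyadic_cube Q) x) * indicator A Q) \<partial>count_space UNIV)"
      by (simp add: nn_integral_cmult)
    also have "\<dots> \<le> (\<integral>\<^sup>+ Q. ennreal ((vol Q powr \<beta> * w Q * indicator (dyadic_cube Q) x) powr p) \<partial>count_space UNIV)"
    proof (rule nn_integral_mono)
      fix Q :: "'n dyadic"
      have "l powr p \<le> w Q powr p" if "Q \<in> A"
        using wl[OF that] l p by (intro powr_mono2) auto
      then show "ennreal (l powr p) * (ennreal (vol Q powr (\<beta> * p) * indicator (dyadic_cube Q) x) * indicator A Q)
          \<le> ennreal ((vol Q powr \<beta> * w Q * indicator (dyadic_cube Q) x) powr p)"
        using True by (auto intro!: ennreal_leI split: split_indicator)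
    qed
    also have "\<dots> = epowr (lq q (\<lambda>Q. vol Q powr \<beta> * w Q * indicator (dyadic_cube Q) x)) p"
      using p \<beta>[OF True] by (simp add: epowr_lq_same)
    finally show "ennreal (1 * l powr p) *
         (\<integral>\<^sup>+ Q. ennreal (vol Q powr (\<beta> * p) * indicator (dyadic_cube Q) x) * indicator A Q \<partial>count_space UNIV)
       \<le> epowr (lq q (\<lambda>Q. vol Q powr \<beta> * w Q * indicator (dyadic_cube Q) x)) p" .
  qed simp
next
  case False
  then have ne: "\<beta> * p \<noteq> 0" using p by simp
  show ?thesis
  proof (rule dyadic_chain_sum_le[OF ne, where 'n = 'n])
    fix C0 assume C0: "0 < C0" and
      chain: "\<And>(x :: real ^ 'n) B S. 0 \<le> B \<Longrightarrow> (\<And>Q. Q \<in> S \<Longrightarrow> x \<in> dyadic_cube Q \<and> vol Q powr (\<beta> * p) \<le> B) \<Longrightarrow>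
         (\<integral>\<^sup>+ Q. ennreal (vol Q powr (\<beta> * p)) * indicator S Q \<partial>count_space UNIV) \<le> ennreal (C0 * B)"
    show ?thesis
    proof
      show "0 < 1 / C0" using C0 by simp
      fix x :: "real ^ 'n" and w :: "'n dyadic \<Rightarrow> real" and l :: real and A :: "'n dyadic set"
      assume l: "0 < l" and w0: "\<And>Q. 0 \<le> w Q" and wl: "\<And>Q. Q \<in> A \<Longrightarrow> l < w Q"
      let ?v = "\<lambda>Q. vol Q powr \<beta> * w Q * indicator (dyadic_cube Q) x"
      show "ennreal (1 / C0 * l powr p) *
           (\<integral>\<^sup>+ Q. ennreal (vol Q powr (\<beta> * p) * indicator (dyadic_cube Q) x) * indicator A Q \<partial>count_space UNIV)
         \<le> epowr (lq q ?v) p"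
      proof (cases "lq q ?v")
        case (real L)
        define S where "S = {Q \<in> A. x \<in> dyadic_cube Q}"
        have "vol Q powr (\<beta> * p) \<le> (L / l) powr p" if "Q \<in> S" for Q
        proof -
          have Q: "Q \<in> A" "x \<in> dyadic_cube Q" using that by (auto simp: S_def)
          have "ennreal (?v Q) \<le> ennreal L"
            using lq_ge[OF q, of ?v Q] w0 real by simp
          then have "vol Q powr \<beta> * w Q \<le> L" using Q real by simp
          moreover have "vol Q powr \<beta> * l \<le> vol Q powr \<beta> * w Q"
            using wl[OF Q(1)] by (intro mult_left_mono) auto
          ultimately have "vol Q powr \<beta> \<le> L / l" using l by (simp add: field_simps)
          then have "(vol Q powr \<beta>) powr p \<le> (L / l) powr p" using p by (intro powr_mono2) auto
          then show ?thesis by (simp add: powr_powr)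
        qed
        then have "(\<integral>\<^sup>+ Q. ennreal (vol Q powr (\<beta> * p)) * indicator S Q \<partial>count_space UNIV) \<le> ennreal (C0 * (L / l) powr p)"
          by (intro chain[where x = x]) (auto simp: S_def)
        then have "ennreal (1 / C0 * l powr p) * (\<integral>\<^sup>+ Q. ennreal (vol Q powr (\<beta> * p)) * indicator S Q \<partial>count_space UNIV)
            \<le> ennreal (1 / C0 * l powr p) * ennreal (C0 * (L / l) powr p)"
          by (rule mult_left_mono) simp
        also have "\<dots> = ennreal (L powr p)"
          using C0 l real by (simp add: powr_divide flip: ennreal_mult)
        also have "(\<integral>\<^sup>+ Q. ennreal (vol Q powr (\<beta> * p)) * indicator S Q \<partial>count_space UNIV)
            = (\<integral>\<^sup>+ Q. ennreal (vol Q powr (\<beta> * p) * indicator (dyadic_cube Q) x) * indicator A Q \<partial>count_space UNIV)"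
          by (intro nn_integral_cong) (auto simp: S_def split: split_indicator)
        finally show ?thesis using real by simp
      qed simp
    qed
  qed
qed

text \<open>For \<open>\<beta> \<noteq> 0\<close> a uniform bound \<open>T\<close> for
  \<open>|Q|^\<beta> w_Q^(1-\<delta>)\<close> on the chain controls the \<open>\<ell>^q\<close>
  quasi-norm by a multiple of \<open>T * M powr \<delta>\<close>. The sum on the right dominates
  each of its terms, so its \<open>p\<close>-th root serves as \<open>T\<close>. Thus an
  \<open>\<ell>^q\<close> expression is replaced by an \<open>\<ell>^p\<close> sum, which can be
  integrated cube by cube.\<close>

lemma lq_cubes_upper:
  fixes \<beta> p \<delta> :: real
  assumes p: "0 < p" and q: "0 < q" and \<beta>: "\<beta> = 0 \<Longrightarrow> q = ennreal p" and \<delta>: "0 < \<delta>" "\<delta> < 1"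
  obtains C where "0 < C"
    "\<And>(x :: real ^ 'n::finite) w M. 0 < M \<Longrightarrow> (\<And>Q. 0 \<le> w Q) \<Longrightarrow> (\<And>Q. w Q \<le> M) \<Longrightarrow>
       epowr (lq q (\<lambda>Q. vol Q powr \<beta> * w Q * indicator (dyadic_cube Q) x)) p
       \<le> ennreal (C * M powr (\<delta> * p)) *
         (\<integral>\<^sup>+ Q. ennreal (vol Q powr (\<beta> * p) * w Q powr ((1 - \<delta>) * p) * indicator (dyadic_cube Q) x) \<partial>count_space UNIV)"
proof -
  have w_split: "w \<le> w powr (1 - \<delta>) * M powr \<delta>" if "0 \<le> w" "w \<le> M" for w M :: real
  proof -
    have "w = w powr (1 - \<delta>) * w powr \<delta>" using that by (simp flip: powr_add)
    also have "\<dots> \<le> w powr (1 - \<delta>) * M powr \<delta>"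
      using that \<delta> by (intro mult_left_mono powr_mono2) auto
    finally show ?thesis .
  qed
  show ?thesis
  proof (cases "\<beta> = 0")
    case True
    show ?thesis
    proof
      fix x :: "real ^ 'n" and w :: "'n dyadic \<Rightarrow> real" and M :: real
      assume M: "0 < M" and w0: "\<And>Q. 0 \<le> w Q" and wM: "\<And>Q. w Q \<le> M"
      have "epowr (lq q (\<lambda>Q. vol Q powr \<beta> * w Q * indicator (dyadic_cube Q) x)) p
          = (\<integral>\<^sup>+ Q. ennreal ((vol Q powr \<beta> * w Q * indicator (dyadic_cube Q) x) powr p) \<partial>count_space UNIV)"
        using p \<beta>[OF True] by (simp add: epowr_lq_same)
      also have "\<dots> \<le> (\<integral>\<^sup>+ Q. ennreal (M powr (\<delta> * p)) *
          ennreal (vol Q powr (\<beta> * p) * w Q powr ((1 - \<delta>) * p) * indicator (dyadic_cube Q) x) \<partial>count_space UNIV)"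
      proof (rule nn_integral_mono)
        fix Q :: "'n dyadic"
        have "w Q powr p \<le> (w Q powr (1 - \<delta>) * M powr \<delta>) powr p"
          using w_split[OF w0 wM] w0 p by (intro powr_mono2) auto
        then show "ennreal ((vol Q powr \<beta> * w Q * indicator (dyadic_cube Q) x) powr p) \<le> ennreal (M powr (\<delta> * p)) *
            ennreal (vol Q powr (\<beta> * p) * w Q powr ((1 - \<delta>) * p) * indicator (dyadic_cube Q) x)"
          using True w0 by (cases "x \<in> dyadic_cube Q")
            (simp_all add: powr_mult powr_powr mult.commute ennreal_leI flip: ennreal_mult)
      qed
      also have "\<dots> = ennreal (1 * M powr (\<delta> * p)) *
         (\<integral>\<^sup>+ Q. ennreal (vol Q powr (\<beta> * p) * w Q powr ((1 - \<delta>) * p) * indicator (dyadic_cube Q) x) \<partial>count_space UNIV)"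
        by (simp add: nn_integral_cmult)
      finally show "epowr (lq q (\<lambda>Q. vol Q powr \<beta> * w Q * indicator (dyadic_cube Q) x)) p \<le> \<dots>" .
    qed simp
  next
    case False
    \<comment> \<open>Only this bound distinguishes finite from infinite \<open>q\<close>: at
      infinity it is \<open>w_split\<close> termwise, otherwise it is the root of the interpolated
      chain sum.\<close>
    have "\<exists>C>0. \<forall>(x :: real ^ 'n) w M T. 0 < M \<longrightarrow> 0 \<le> T \<longrightarrow> (\<forall>Q. 0 \<le> w Q) \<longrightarrow> (\<forall>Q. w Q \<le> M) \<longrightarrow>
       (\<forall>Q. x \<in> dyadic_cube Q \<longrightarrow> vol Q powr \<beta> * w Q powr (1 - \<delta>) \<le> T) \<longrightarrow>
       lq q (\<lambda>Q. vol Q powr \<beta> * w Q * indicator (dyadic_cube Q) x) \<le> ennreal (C * (T * M powr \<delta>))"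
      using q
    proof (cases q rule: ennreal_exponent_cases)
      case top
      have "lq q (\<lambda>Q. vol Q powr \<beta> * w Q * indicator (dyadic_cube Q) x) \<le> ennreal (1 * (T * M powr \<delta>))"
        if "0 < M" "0 \<le> T" "\<forall>Q. 0 \<le> w Q" "\<forall>Q. w Q \<le> M"
          "\<forall>Q. x \<in> dyadic_cube Q \<longrightarrow> vol Q powr \<beta> * w Q powr (1 - \<delta>) \<le> T" for x :: "real ^ 'n" and w M T
      proof -
        have "vol Q powr \<beta> * w Q * indicator (dyadic_cube Q) x \<le> T * M powr \<delta>" for Q
        proof (cases "x \<in> dyadic_cube Q")
          case True
          have "vol Q powr \<beta> * w Q \<le> vol Q powr \<beta> * (w Q powr (1 - \<delta>) * M powr \<delta>)"
            using w_split[of "w Q" M] that(3,4) by (intro mult_left_mono) (blast, simp)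
          also have "\<dots> = vol Q powr \<beta> * w Q powr (1 - \<delta>) * M powr \<delta>"
            by simp
          also have "\<dots> \<le> T * M powr \<delta>"
            using that(5) True by (intro mult_right_mono) (blast, simp)
          finally show ?thesis using True by simp
        qed (use that(1,2) in auto)
        then show ?thesis using top by (auto simp: lq_def intro!: SUP_least ennreal_leI)
      qed
      then show ?thesis by (intro exI[of _ 1] conjI allI impI) simp_all
    next
      case (real r)
      show ?thesis
      proof (rule chain_sum_interpolation[OF False real(2) \<delta>, where 'n = 'n])
        fix C assume C: "0 < C" and
          core: "\<And>(x :: real ^ 'n) w M T. 0 < M \<Longrightarrow> 0 \<le> T \<Longrightarrow> (\<And>Q. 0 \<le> w Q) \<Longrightarrow> (\<And>Q. w Q \<le> M) \<Longrightarrow>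
             (\<And>Q. x \<in> dyadic_cube Q \<Longrightarrow> vol Q powr \<beta> * w Q powr (1 - \<delta>) \<le> T) \<Longrightarrow>
             (\<integral>\<^sup>+ Q. ennreal ((vol Q powr \<beta> * w Q * indicator (dyadic_cube Q) x) powr r) \<partial>count_space UNIV)
               \<le> ennreal (C * (T * M powr \<delta>) powr r)"
        have "lq q (\<lambda>Q. vol Q powr \<beta> * w Q * indicator (dyadic_cube Q) x) \<le> ennreal (C powr (1 / r) * (T * M powr \<delta>))"
          if "0 < M" "0 \<le> T" "\<forall>Q. 0 \<le> w Q" "\<forall>Q. w Q \<le> M"
            "\<forall>Q. x \<in> dyadic_cube Q \<longrightarrow> vol Q powr \<beta> * w Q powr (1 - \<delta>) \<le> T" for x :: "real ^ 'n" and w M T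
        proof -
          have "(\<integral>\<^sup>+ Q. ennreal ((vol Q powr \<beta> * w Q * indicator (dyadic_cube Q) x) powr r) \<partial>count_space UNIV)
               \<le> ennreal (C * (T * M powr \<delta>) powr r)"
            using that by (intro core) blast+
          then have "lq q (\<lambda>Q. vol Q powr \<beta> * w Q * indicator (dyadic_cube Q) x)
              \<le> epowr (ennreal (C * (T * M powr \<delta>) powr r)) (1 / r)"
            using real by (simp add: lq_def recip_ennreal epowr_mono)
          also have "\<dots> = ennreal (C powr (1 / r) * (T * M powr \<delta>))"
            using C that(1,2) real by (simp add: powr_mult powr_powr)
          finally show ?thesis .
        qed
        then show ?thesis using C by (intro exI[of _ "C powr (1 / r)"] conjI allI impI) simp_all
      qed
    qed
    then obtain C where C: "0 < C" and
      bd: "\<And>(x :: real ^ 'n) w M T. 0 < M \<Longrightarrow> 0 \<le> T \<Longrightarrow> (\<And>Q. 0 \<le> w Q) \<Longrightarrow> (\<And>Q. w Q \<le> M) \<Longrightarrow>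
       (\<And>Q. x \<in> dyadic_cube Q \<Longrightarrow> vol Q powr \<beta> * w Q powr (1 - \<delta>) \<le> T) \<Longrightarrow>
       lq q (\<lambda>Q. vol Q powr \<beta> * w Q * indicator (dyadic_cube Q) x) \<le> ennreal (C * (T * M powr \<delta>))"
      by (elim exE conjE) (rule that, assumption, blast)
    show ?thesis
    proof
      show "0 < C powr p" using C by simp
      fix x :: "real ^ 'n" and w :: "'n dyadic \<Rightarrow> real" and M :: real
      assume M: "0 < M" and w0: "\<And>Q. 0 \<le> w Q" and wM: "\<And>Q. w Q \<le> M"
      let ?G = "\<lambda>Q. ennreal (vol Q powr (\<beta> * p) * w Q powr ((1 - \<delta>) * p) * indicator (dyadic_cube Q) x)"
      show "epowr (lq q (\<lambda>Q. vol Q powr \<beta> * w Q * indicator (dyadic_cube Q) x)) p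
          \<le> ennreal (C powr p * M powr (\<delta> * p)) * (\<integral>\<^sup>+ Q. ?G Q \<partial>count_space UNIV)"
      proof (cases "\<integral>\<^sup>+ Q. ?G Q \<partial>count_space UNIV")
        case top
        then show ?thesis using C M by (simp add: ennreal_mult_top)
      next
        case (real i)
        \<comment> \<open>A sum of nonnegative terms dominates each term, so this root bounds
          \<open>|Q|^\<beta> w_Q^(1-\<delta>)\<close> for all cubes through
          \<open>x\<close>.\<close>
        define T where "T = i powr (1 / p)"
        have "vol Q powr \<beta> * w Q powr (1 - \<delta>) \<le> T" if "x \<in> dyadic_cube Q" for Q
        proof -
          have "?G Q \<le> ennreal i"
            unfolding real(2)[symmetric] by (rule nn_integral_ge_point) simp
          then have "vol Q powr (\<beta> * p) * w Q powr ((1 - \<delta>) * p) \<le> i"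
            using that real by simp
          then have "(vol Q powr (\<beta> * p) * w Q powr ((1 - \<delta>) * p)) powr (1 / p) \<le> T"
            unfolding T_def using p by (intro powr_mono2) auto
          then show ?thesis using p w0 by (simp add: powr_mult powr_powr)
        qed
        then have "lq q (\<lambda>Q. vol Q powr \<beta> * w Q * indicator (dyadic_cube Q) x) \<le> ennreal (C * (T * M powr \<delta>))"
          using M w0 wM by (intro bd) (auto simp: T_def)
        then have "epowr (lq q (\<lambda>Q. vol Q powr \<beta> * w Q * indicator (dyadic_cube Q) x)) p
            \<le> epowr (ennreal (C * (T * M powr \<delta>))) p"
          using p by (intro epowr_mono) auto
        also have "\<dots> = ennreal (C powr p * M powr (\<delta> * p) * i)"
          using C M p real by (simp add: T_def powr_mult powr_powr mult_ac)
        also have "\<dots> = ennreal (C powr p * M powr (\<delta> * p)) * (\<integral>\<^sup>+ Q. ?G Q \<partial>count_space UNIV)"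
          using real by (simp add: ennreal_mult)
        finally show ?thesis .
      qed
    qed
  qed
qed

section \<open>Bounds for the quasi-norm\<close>

text \<open>The quasi-norm of \<open>f\<close> rewritten in the weighted entries
  \<open>u_Q |a_Q|\<close>; the smoothness parameters then enter only through
  \<open>\<beta>\<close>.\<close>

definition cube_norm :: "real \<Rightarrow> real \<Rightarrow> ennreal \<Rightarrow> ('n::finite dyadic \<Rightarrow> real) \<Rightarrow> ennreal" where
  "cube_norm \<beta> p q w =
     epowr (\<integral>\<^sup>+ x. epowr (lq q (\<lambda>Q. vol Q powr \<beta> * w Q * indicator (dyadic_cube Q) x)) p \<partial>lborel) (1 / p)"

text \<open>Tonelli over the countable family of cubes. The extra factor \<open>|Q|\<close> turns
  the exponent \<open>\<beta> * p\<close> of the pointwise bounds into the exponent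
  \<open>\<beta> * p + 1\<close> of the measure.\<close>

lemma nn_integral_lborel_cubes:
  fixes g :: "'n::finite dyadic \<Rightarrow> real"
  assumes "\<And>Q. 0 \<le> g Q"
  shows "(\<integral>\<^sup>+ x. \<integral>\<^sup>+ Q. ennreal (g Q * indicator (dyadic_cube Q) x) \<partial>count_space UNIV \<partial>lborel)
    = (\<integral>\<^sup>+ Q. ennreal (g Q * vol Q) \<partial>count_space UNIV)"
proof -
  have "(\<integral>\<^sup>+ x. \<integral>\<^sup>+ Q. ennreal (g Q * indicator (dyadic_cube Q) x) \<partial>count_space UNIV \<partial>lborel)
    = (\<integral>\<^sup>+ Q. \<integral>\<^sup>+ x. ennreal (g Q * indicator (dyadic_cube Q) x) \<partial>lborel \<partial>count_space UNIV)"
    by (rule nn_integral_count_space_nn_integral) auto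
  also have "\<dots> = (\<integral>\<^sup>+ Q. ennreal (g Q * vol Q) \<partial>count_space UNIV)"
  proof (rule nn_integral_cong)
    fix Q :: "'n dyadic"
    have "(\<integral>\<^sup>+ x. ennreal (g Q * indicator (dyadic_cube Q) x) \<partial>lborel)
        = (\<integral>\<^sup>+ x. ennreal (g Q) * indicator (dyadic_cube Q) x \<partial>lborel)"
      by (intro nn_integral_cong) (simp split: split_indicator)
    also have "\<dots> = ennreal (g Q * vol Q)"
      using assms by (simp add: nn_integral_cmult_indicator emeasure_dyadic_cube less_imp_le flip: ennreal_mult)
    finally show "(\<integral>\<^sup>+ x. ennreal (g Q * indicator (dyadic_cube Q) x) \<partial>lborel) = ennreal (g Q * vol Q)" .
  qed
  finally show ?thesis .
qed

lemma sets_dyadic_measure [simp]: "sets (dyadic_measure \<alpha>) = UNIV"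
  by (simp add: dyadic_measure_def sets_point_measure)

text \<open>The weak-type bound: \<open>lq_cubes_lower\<close> is integrated in \<open>x\<close>,
  and the sum over \<open>A\<close> becomes its measure.\<close>

lemma cube_norm_lower:
  fixes \<beta> p :: real
  assumes p: "0 < p" and q: "0 < q" and \<beta>: "\<beta> = 0 \<Longrightarrow> q = ennreal p"
  obtains c where "0 < c"
    "\<And>(w :: 'n::finite dyadic \<Rightarrow> real) l A. 0 < l \<Longrightarrow> (\<And>Q. 0 \<le> w Q) \<Longrightarrow> (\<And>Q. Q \<in> A \<Longrightarrow> l < w Q) \<Longrightarrow>
       ennreal (c * l) * epowr (emeasure (dyadic_measure (\<beta> * p + 1)) A) (1 / p) \<le> cube_norm \<beta> p q w"
proof (rule lq_cubes_lower[OF p q \<beta>, where 'n = 'n])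
  fix c :: real
  assume c: "0 < c" and lower: "\<And>(x :: real ^ 'n) w l A. 0 < l \<Longrightarrow> (\<And>Q. 0 \<le> w Q) \<Longrightarrow> (\<And>Q. Q \<in> A \<Longrightarrow> l < w Q) \<Longrightarrow>
       ennreal (c * l powr p) *
         (\<integral>\<^sup>+ Q. ennreal (vol Q powr (\<beta> * p) * indicator (dyadic_cube Q) x) * indicator A Q \<partial>count_space UNIV)
       \<le> epowr (lq q (\<lambda>Q. vol Q powr \<beta> * w Q * indicator (dyadic_cube Q) x)) p"
  show ?thesis
  proof
    show "0 < c powr (1 / p)" using c by simp
    fix w :: "'n dyadic \<Rightarrow> real" and l :: real and A
    assume l: "0 < l" and w: "\<And>Q. 0 \<le> w Q" "\<And>Q. Q \<in> A \<Longrightarrow> l < w Q"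
    \<comment> \<open>The constant and the indicator of \<open>A\<close> are absorbed into one
      coefficient per cube, the form that Tonelli is stated for.\<close>
    define g where "g Q = c * l powr p * vol Q powr (\<beta> * p) * indicator A Q" for Q :: "'n dyadic"
    have "(\<integral>\<^sup>+ x. \<integral>\<^sup>+ Q. ennreal (g Q * indicator (dyadic_cube Q) x) \<partial>count_space UNIV \<partial>lborel)
        \<le> (\<integral>\<^sup>+ x. epowr (lq q (\<lambda>Q. vol Q powr \<beta> * w Q * indicator (dyadic_cube Q) x)) p \<partial>lborel)"
    proof (rule nn_integral_mono)
      fix x :: "real ^ 'n"
      have "(\<integral>\<^sup>+ Q. ennreal (g Q * indicator (dyadic_cube Q) x) \<partial>count_space UNIV)
          = (\<integral>\<^sup>+ Q. ennreal (c * l powr p) * (ennreal (vol Q powr (\<beta> * p) * indicator (dyadic_cube Q) x) * indicator A Q) \<partial>count_space UNIV)"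
        using c by (intro nn_integral_cong) (simp add: g_def ennreal_mult split: split_indicator)
      also have "\<dots> = ennreal (c * l powr p) *
         (\<integral>\<^sup>+ Q. ennreal (vol Q powr (\<beta> * p) * indicator (dyadic_cube Q) x) * indicator A Q \<partial>count_space UNIV)"
        by (rule nn_integral_cmult) simp
      also have "\<dots> \<le> epowr (lq q (\<lambda>Q. vol Q powr \<beta> * w Q * indicator (dyadic_cube Q) x)) p"
        by (rule lower[OF l w])
      finally show "(\<integral>\<^sup>+ Q. ennreal (g Q * indicator (dyadic_cube Q) x) \<partial>count_space UNIV) \<le> \<dots>" .
    qed
    moreover have "(\<integral>\<^sup>+ x. \<integral>\<^sup>+ Q. ennreal (g Q * indicator (dyadic_cube Q) x) \<partial>count_space UNIV \<partial>lborel)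
        = (\<integral>\<^sup>+ Q. ennreal (g Q * vol Q) \<partial>count_space UNIV)"
      using c by (intro nn_integral_lborel_cubes) (simp add: g_def)
    moreover have "(\<integral>\<^sup>+ Q. ennreal (g Q * vol Q) \<partial>count_space UNIV)
        = (\<integral>\<^sup>+ Q. ennreal (c * l powr p) * (ennreal (vol Q powr (\<beta> * p + 1)) * indicator A Q) \<partial>count_space UNIV)"
      using c by (intro nn_integral_cong)
        (simp add: g_def powr_add less_imp_le ennreal_mult mult.assoc split: split_indicator)
    moreover have "\<dots> = ennreal (c * l powr p) * emeasure (dyadic_measure (\<beta> * p + 1)) A"
      unfolding emeasure_dyadic_measure by (rule nn_integral_cmult) simp
    ultimately have "ennreal (c * l powr p) * emeasure (dyadic_measure (\<beta> * p + 1)) A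
        \<le> (\<integral>\<^sup>+ x. epowr (lq q (\<lambda>Q. vol Q powr \<beta> * w Q * indicator (dyadic_cube Q) x)) p \<partial>lborel)"
      by simp
    then have "epowr (ennreal (c * l powr p) * emeasure (dyadic_measure (\<beta> * p + 1)) A) (1 / p) \<le> cube_norm \<beta> p q w"
      unfolding cube_norm_def using p by (intro epowr_mono) simp_all
    moreover have "epowr (ennreal (c * l powr p)) (1 / p) = ennreal (c powr (1 / p) * l)"
      using c l p by (simp add: powr_mult powr_powr)
    ultimately show "ennreal (c powr (1 / p) * l) * epowr (emeasure (dyadic_measure (\<beta> * p + 1)) A) (1 / p) \<le> cube_norm \<beta> p q w"
      by (simp add: epowr_mult)
  qed
qed

text \<open>Integration of \<open>lq_cubes_upper\<close> in \<open>x\<close>. The real bound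
  \<open>I\<close> keeps the right side a real power product, whose homogeneity is needed
  later.\<close>

lemma cube_norm_upper:
  fixes \<beta> p \<delta> :: real
  assumes p: "0 < p" and q: "0 < q" and \<beta>: "\<beta> = 0 \<Longrightarrow> q = ennreal p" and \<delta>: "0 < \<delta>" "\<delta> < 1"
  obtains C where "0 < C"
    "\<And>(w :: 'n::finite dyadic \<Rightarrow> real) M I. 0 < M \<Longrightarrow> 0 \<le> I \<Longrightarrow> (\<And>Q. 0 \<le> w Q) \<Longrightarrow> (\<And>Q. w Q \<le> M) \<Longrightarrow>
       (\<integral>\<^sup>+ Q. ennreal (w Q powr ((1 - \<delta>) * p) * vol Q powr (\<beta> * p + 1)) \<partial>count_space UNIV) \<le> ennreal I \<Longrightarrow>
       cube_norm \<beta> p q w \<le> ennreal (C * M powr \<delta> * I powr (1 / p))"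
proof (rule lq_cubes_upper[OF p q \<beta> \<delta>, where 'n = 'n])
  fix C :: real
  assume C: "0 < C" and upper: "\<And>(x :: real ^ 'n) w M. 0 < M \<Longrightarrow> (\<And>Q. 0 \<le> w Q) \<Longrightarrow> (\<And>Q. w Q \<le> M) \<Longrightarrow>
       epowr (lq q (\<lambda>Q. vol Q powr \<beta> * w Q * indicator (dyadic_cube Q) x)) p
       \<le> ennreal (C * M powr (\<delta> * p)) *
         (\<integral>\<^sup>+ Q. ennreal (vol Q powr (\<beta> * p) * w Q powr ((1 - \<delta>) * p) * indicator (dyadic_cube Q) x) \<partial>count_space UNIV)"
  show ?thesis
  proof
    show "0 < C powr (1 / p)" using C by simp
    fix w :: "'n dyadic \<Rightarrow> real" and M I :: real
    assume M: "0 < M" and I: "0 \<le> I" and w: "\<And>Q. 0 \<le> w Q" "\<And>Q. w Q \<le> M"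
      and le: "(\<integral>\<^sup>+ Q. ennreal (w Q powr ((1 - \<delta>) * p) * vol Q powr (\<beta> * p + 1)) \<partial>count_space UNIV) \<le> ennreal I"
    define K where "K = C * M powr (\<delta> * p)"
    have K: "0 < K" using C M by (simp add: K_def)
    define g where "g Q = K * (vol Q powr (\<beta> * p) * w Q powr ((1 - \<delta>) * p))" for Q :: "'n dyadic"
    have "(\<integral>\<^sup>+ x. epowr (lq q (\<lambda>Q. vol Q powr \<beta> * w Q * indicator (dyadic_cube Q) x)) p \<partial>lborel)
      \<le> (\<integral>\<^sup>+ x. \<integral>\<^sup>+ Q. ennreal (g Q * indicator (dyadic_cube Q) x) \<partial>count_space UNIV \<partial>lborel)"
    proof (rule nn_integral_mono)
      fix x :: "real ^ 'n"
      have "epowr (lq q (\<lambda>Q. vol Q powr \<beta> * w Q * indicator (dyadic_cube Q) x)) p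
        \<le> ennreal K *
          (\<integral>\<^sup>+ Q. ennreal (vol Q powr (\<beta> * p) * w Q powr ((1 - \<delta>) * p) * indicator (dyadic_cube Q) x) \<partial>count_space UNIV)"
        unfolding K_def by (rule upper[OF M w])
      also have "\<dots> = (\<integral>\<^sup>+ Q. ennreal K * ennreal (vol Q powr (\<beta> * p) * w Q powr ((1 - \<delta>) * p) * indicator (dyadic_cube Q) x) \<partial>count_space UNIV)"
        by (rule nn_integral_cmult[symmetric]) simp
      also have "\<dots> = (\<integral>\<^sup>+ Q. ennreal (g Q * indicator (dyadic_cube Q) x) \<partial>count_space UNIV)"
        using K by (intro nn_integral_cong) (simp add: g_def ennreal_mult split: split_indicator)
      finally show "epowr (lq q (\<lambda>Q. vol Q powr \<beta> * w Q * indicator (dyadic_cube Q) x)) p \<le> \<dots>" .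
    qed
    also have "\<dots> = (\<integral>\<^sup>+ Q. ennreal (g Q * vol Q) \<partial>count_space UNIV)"
      using K by (intro nn_integral_lborel_cubes) (simp add: g_def)
    also have "\<dots> = (\<integral>\<^sup>+ Q. ennreal K * ennreal (w Q powr ((1 - \<delta>) * p) * vol Q powr (\<beta> * p + 1)) \<partial>count_space UNIV)"
      using K by (intro nn_integral_cong) (simp add: g_def powr_add less_imp_le mult_ac flip: ennreal_mult)
    also have "\<dots> = ennreal K * (\<integral>\<^sup>+ Q. ennreal (w Q powr ((1 - \<delta>) * p) * vol Q powr (\<beta> * p + 1)) \<partial>count_space UNIV)"
      by (rule nn_integral_cmult) simp
    also have "\<dots> \<le> ennreal K * ennreal I"
      by (intro mult_left_mono le) simp
    also have "\<dots> = ennreal (K * I)"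
      using K I by (simp add: ennreal_mult)
    finally have "cube_norm \<beta> p q w \<le> epowr (ennreal (K * I)) (1 / p)"
      unfolding cube_norm_def using p by (intro epowr_mono) simp_all
    also have "\<dots> = ennreal (C powr (1 / p) * M powr \<delta> * I powr (1 / p))"
      using K I p by (simp add: K_def powr_mult powr_powr)
    finally show "cube_norm \<beta> p q w \<le> ennreal (C powr (1 / p) * M powr \<delta> * I powr (1 / p))" .
  qed
qed

section \<open>Reduction of the original quasi-norms to weighted entries\<close>

lemma f_term_eq:
  fixes Q :: "'n::finite dyadic"
  shows "f_term s r a Q x = vol Q powr (- s / real CARD('n) - 1 / 2) * cmod (a Q) * indicator (dyadic_cube Q) x"
proof -
  \<comment> \<open>The normalization of the characteristic function cancels the factor
    \<open>|Q|^(1/r)\<close>, so \<open>r\<close> survives only as the exponent of the inner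
    norm.\<close>
  have "vol Q powr (- s / real CARD('n) + recip r - 1 / 2) * vol Q powr (- recip r)
      = vol Q powr (- s / real CARD('n) - 1 / 2)"
    by (simp flip: powr_add)
  then show ?thesis
    by (simp add: f_term_def chi_normalized_def mult_ac split: split_indicator)
qed

lemma f_inner_eq: "f_inner s r a x = lq r (\<lambda>Q. f_term s r a Q x)"
  by (simp add: f_inner_def lq_def)

lemma lq_single:
  assumes "0 < r" "0 \<le> v i" "\<And>j. j \<noteq> i \<Longrightarrow> v j = 0"
  shows "lq r v = ennreal (v i)"
  using assms(1)
proof (cases r rule: ennreal_exponent_cases)
  case top
  have "(SUP j. ennreal (v j)) \<le> ennreal (v i)"
    using assms(3) by (intro SUP_least) (metis ennreal_0 order_refl zero_le)
  moreover have "ennreal (v i) \<le> (SUP j. ennreal (v j))"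
    by (rule SUP_upper) simp
  ultimately show ?thesis using top by (simp add: lq_def)
next
  case (real r')
  have "(\<integral>\<^sup>+ j. ennreal (v j powr r') \<partial>count_space UNIV)
      = (\<integral>\<^sup>+ j. ennreal (v i powr r') * indicator {i} j \<partial>count_space UNIV)"
    using assms(3) real by (intro nn_integral_cong) (simp split: split_indicator)
  then show ?thesis
    using real assms(2) by (simp add: lq_def recip_ennreal powr_powr nn_integral_cmult_indicator)
qed

text \<open>The inner family has a single nonzero term, so its quasi-norm is that term for every
  \<open>r\<close>, and integration contributes \<open>|Q|^(1/p)\<close>.\<close>

lemma unit_weight_eq:
  fixes Q :: "'n::finite dyadic"
  assumes "0 < p" "0 < r"
  shows "unit_weight s p r Q = vol Q powr (- s / real CARD('n) - 1 / 2 + 1 / p)"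
proof -
  define e where "e = - s / real CARD('n) - 1 / 2"
  have "epowr (f_inner s r (unit_seq Q) x) p = ennreal (vol Q powr (e * p)) * indicator (dyadic_cube Q) x" for x
  proof -
    have "f_inner s r (unit_seq Q) x = ennreal (f_term s r (unit_seq Q) Q x)"
      unfolding f_inner_eq using assms by (intro lq_single) (simp_all add: f_term_eq unit_seq_def)
    then show ?thesis
      using assms by (simp add: f_term_eq unit_seq_def e_def powr_powr split: split_indicator)
  qed
  then have "f_norm s p r (unit_seq Q) = epowr (ennreal (vol Q powr (e * p) * vol Q)) (1 / p)"
    by (simp add: f_norm_def nn_integral_cmult_indicator emeasure_dyadic_cube less_imp_le flip: ennreal_mult)
  also have "\<dots> = ennreal (vol Q powr (e + 1 / p))"
    using assms by (simp add: powr_mult powr_powr powr_add less_imp_le)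
  finally show ?thesis by (simp add: unit_weight_def e_def)
qed

text \<open>Here \<open>\<beta>\<close> is the exponent \<open>- s1 / d - 1 / 2\<close> of the
  volume in the terms of the first space minus the exponent of the volume in
  \<open>u_Q\<close>.\<close>

lemma f_norm_eq_cube_norm:
  fixes a :: "'n::finite dyadic_seq"
  assumes "0 < p1" "0 < p2" "0 < q2"
    and "\<beta> = (s2 - s1) / real CARD('n) - 1 / p2"
  shows "f_norm s1 p1 q1 a = cube_norm \<beta> p1 q1 (\<lambda>Q. unit_weight s2 p2 q2 Q * cmod (a Q))"
proof -
  have "vol Q powr (- s1 / real CARD('n) - 1 / 2) = vol Q powr \<beta> * unit_weight s2 p2 q2 Q" for Q :: "'n dyadic"
    using assms by (simp add: unit_weight_eq diff_divide_distrib flip: powr_add)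
  then have "f_term s1 q1 a Q x = vol Q powr \<beta> * (unit_weight s2 p2 q2 Q * cmod (a Q)) * indicator (dyadic_cube Q) x" for Q x
    by (simp add: f_term_eq mult.assoc)
  then show ?thesis
    by (simp add: f_norm_def f_inner_eq cube_norm_def)
qed

section \<open>Approximation error and rearrangement\<close>

lemma rearrangement_antimono: "t \<le> t' \<Longrightarrow> rearrangement \<nu> a t' \<le> rearrangement \<nu> a t"
  unfolding rearrangement_def
  by (intro INF_superset_mono) (use ennreal_leI order_trans in blast)+

text \<open>The infimum is attained: the level set at \<open>l\<close> is the increasing union of
  those at \<open>l + 1 / (n + 1)\<close>, each inside an admissible level set, and measures are
  continuous from below. This includes \<open>l = 0\<close>, although the infimum runs over positive
  levels.\<close>

lemma emeasure_le_of_rearrangement_le: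
  assumes sets: "sets \<nu> = UNIV" and l: "0 \<le> l" and le: "rearrangement \<nu> a t \<le> ennreal l"
  shows "emeasure \<nu> {Q. cmod (a Q) > l} \<le> ennreal t"
proof -
  define A where "A n = {Q. cmod (a Q) > l + 1 / real (Suc n)}" for n
  have "emeasure \<nu> (A n) \<le> ennreal t" for n
  proof -
    have "ennreal l < ennreal (l + 1 / real (Suc n))"
      using l by (intro ennreal_lessI add_nonneg_pos) simp_all
    then have "rearrangement \<nu> a t < ennreal (l + 1 / real (Suc n))"
      using le by order
    then obtain l' where l': "0 < l'" "emeasure \<nu> {Q. cmod (a Q) > l'} \<le> ennreal t"
        "ennreal l' < ennreal (l + 1 / real (Suc n))"
      unfolding rearrangement_def INF_less_iff by blast
    then have "l' < l + 1 / real (Suc n)"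
      by (simp add: ennreal_less_iff)
    then have "emeasure \<nu> (A n) \<le> emeasure \<nu> {Q. cmod (a Q) > l'}"
      by (intro emeasure_mono) (auto simp: A_def sets)
    then show ?thesis using l'(2) by order
  qed
  moreover have "(SUP n. emeasure \<nu> (A n)) = emeasure \<nu> (\<Union>n. A n)"
  proof (rule SUP_emeasure_incseq)
    show "incseq A"
    proof (rule incseq_SucI)
      fix n
      have "1 / real (Suc (Suc n)) \<le> 1 / real (Suc n)" by (intro divide_left_mono) auto
      then show "A n \<le> A (Suc n)" unfolding A_def by (intro Collect_mono impI) linarith
    qed
  qed (simp add: sets)
  moreover have "(\<Union>n. A n) = {Q. cmod (a Q) > l}"
  proof (intro set_eqI iffI)
    fix Q assume "Q \<in> (\<Union>n. A n)"
    then obtain n where "l + 1 / real (Suc n) < cmod (a Q)" by (auto simp: A_def)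
    moreover have "0 < 1 / real (Suc n)" by simp
    ultimately show "Q \<in> {Q. cmod (a Q) > l}" unfolding mem_Collect_eq by linarith
  next
    fix Q assume "Q \<in> {Q. cmod (a Q) > l}"
    then have "0 < cmod (a Q) - l" by simp
    then obtain n where "1 / real (Suc n) < cmod (a Q) - l"
      using nat_approx_posE by blast
    then have "Q \<in> A n" unfolding A_def mem_Collect_eq by linarith
    then show "Q \<in> (\<Union>n. A n)" by blast
  qed
  ultimately show ?thesis by (metis SUP_least)
qed

section \<open>Pointwise comparison of approximation error and rearrangement\<close>

lemma less_emeasure_of_less_rearrangement:
  assumes "0 < l" "ennreal l < rearrangement \<nu> a t"
  shows "ennreal t < emeasure \<nu> {Q. cmod (a Q) > l}"
proof (rule ccontr)
  assume "\<not> ?thesis"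
  then have "rearrangement \<nu> a t \<le> ennreal l"
    unfolding rearrangement_def using assms(1) by (intro INF_lower) simp
  then show False using assms(2) by order
qed

text \<open>For \<open>l\<close> below the rearrangement at \<open>2 * t\<close>, the level set has
  measure above \<open>2 * t\<close>. A competitor supported on measure at most \<open>t\<close>
  leaves \<open>a\<close> unchanged on a part of measure at least \<open>t\<close>, where the
  weak-type bound applies.\<close>

lemma approx_error_lower:
  fixes \<beta> p :: real
  assumes p: "0 < p" and q: "0 < q" and \<beta>: "\<beta> = 0 \<Longrightarrow> q = ennreal p"
  obtains c where "0 < c"
    "\<And>(u :: 'n::finite dyadic \<Rightarrow> real) a t. (\<And>Q. 0 \<le> u Q) \<Longrightarrow> 0 < t \<Longrightarrow>
       ennreal (c * t powr (1 / p)) * rearrangement (dyadic_measure (\<beta> * p + 1)) (\<lambda>Q. of_real (u Q) * a Q) (2 * t)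
       \<le> approx_error (\<lambda>b. cube_norm \<beta> p q (\<lambda>Q. u Q * cmod (b Q))) (dyadic_measure (\<beta> * p + 1)) t a"
proof (rule cube_norm_lower[OF p q \<beta>, where 'n = 'n])
  fix c :: real
  define \<nu> :: "'n dyadic measure" where "\<nu> = dyadic_measure (\<beta> * p + 1)"
  assume c: "0 < c" and "\<And>(w :: 'n dyadic \<Rightarrow> real) l A. 0 < l \<Longrightarrow> (\<And>Q. 0 \<le> w Q) \<Longrightarrow> (\<And>Q. Q \<in> A \<Longrightarrow> l < w Q) \<Longrightarrow>
       ennreal (c * l) * epowr (emeasure (dyadic_measure (\<beta> * p + 1)) A) (1 / p) \<le> cube_norm \<beta> p q w"
  then have lower: "\<And>(w :: 'n dyadic \<Rightarrow> real) l A. 0 < l \<Longrightarrow> (\<And>Q. 0 \<le> w Q) \<Longrightarrow> (\<And>Q. Q \<in> A \<Longrightarrow> l < w Q) \<Longrightarrow>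
       ennreal (c * l) * epowr (emeasure \<nu> A) (1 / p) \<le> cube_norm \<beta> p q w"
    unfolding \<nu>_def by blast
  show ?thesis
  proof (rule that, unfold \<nu>_def[symmetric])
    show "0 < c" by (rule c)
    fix u :: "'n dyadic \<Rightarrow> real" and a :: "'n dyadic_seq" and t :: real
    assume u: "\<And>Q. 0 \<le> u Q" and t: "0 < t"
    define d where "d = (\<lambda>Q. of_real (u Q) * a Q)"
    have d: "cmod (d Q) = u Q * cmod (a Q)" for Q
      using u[of Q] by (simp add: d_def norm_mult)
    show "ennreal (c * t powr (1 / p)) * rearrangement \<nu> d (2 * t)
       \<le> approx_error (\<lambda>b. cube_norm \<beta> p q (\<lambda>Q. u Q * cmod (b Q))) \<nu> t a"
      unfolding approx_error_def
    proof (rule INF_greatest)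
      fix b assume "b \<in> Sigma_set \<nu> t"
      then obtain \<Gamma> where \<Gamma>: "emeasure \<nu> \<Gamma> \<le> ennreal t" "\<And>Q. Q \<notin> \<Gamma> \<Longrightarrow> b Q = 0"
        by (auto simp: Sigma_set_def)
      let ?N = "cube_norm \<beta> p q (\<lambda>Q. u Q * cmod (a Q - b Q))"
      let ?K = "c * t powr (1 / p)"
      have K: "0 < ?K" using c t by simp
      have "ennreal (?K * l) \<le> ?N" if l: "0 < l" "ennreal l < rearrangement \<nu> d (2 * t)" for l
      proof -
        define E where "E = {Q. cmod (d Q) > l}"
        have "ennreal t + ennreal t = ennreal (2 * t)" using t by (simp flip: ennreal_plus)
        also have "\<dots> \<le> emeasure \<nu> E"
          using less_emeasure_of_less_rearrangement[OF l] by (simp add: E_def)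
        also have "\<dots> \<le> emeasure \<nu> ((E - \<Gamma>) \<union> \<Gamma>)"
          by (intro emeasure_mono) (auto simp: \<nu>_def)
        also have "\<dots> \<le> emeasure \<nu> (E - \<Gamma>) + emeasure \<nu> \<Gamma>"
          by (intro emeasure_subadditive) (auto simp: \<nu>_def)
        also have "\<dots> \<le> emeasure \<nu> (E - \<Gamma>) + ennreal t"
          using \<Gamma>(1) by (intro add_left_mono)
        finally have "ennreal t \<le> emeasure \<nu> (E - \<Gamma>)"
          by (simp add: ennreal_add_left_cancel_le add.commute)
        then have "epowr (ennreal t) (1 / p) \<le> epowr (emeasure \<nu> (E - \<Gamma>)) (1 / p)"
          using p by (intro epowr_mono) simp_all
        then have "ennreal (c * l) * ennreal (t powr (1 / p)) \<le> ennreal (c * l) * epowr (emeasure \<nu> (E - \<Gamma>)) (1 / p)"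
          using t by (intro mult_left_mono) simp_all
        also have "\<dots> \<le> ?N"
          using l u \<Gamma>(2) by (intro lower) (simp_all add: E_def d)
        finally show ?thesis
          using c l by (simp add: mult_ac flip: ennreal_mult)
      qed
      note bound = this
      \<comment> \<open>Approaching the rearrangement from below by real levels also covers the case
        that it is infinite.\<close>
      have "rearrangement \<nu> d (2 * t) \<le> ennreal (1 / ?K) * ?N"
      proof (rule dense_le)
        fix y assume y: "y < rearrangement \<nu> d (2 * t)"
        then obtain l where l: "0 \<le> l" "y = ennreal l" by (cases y) auto
        show "y \<le> ennreal (1 / ?K) * ?N"
        proof (cases "l = 0")
          case False
          have "y = ennreal (1 / ?K) * ennreal (?K * l)"
            using l c t by (simp flip: ennreal_mult)
          also have "\<dots> \<le> ennreal (1 / ?K) * ?N"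
            using False bound[of l] l y by (intro mult_left_mono) simp_all
          finally show ?thesis .
        qed (simp add: l)
      qed
      then have "ennreal ?K * rearrangement \<nu> d (2 * t) \<le> ennreal ?K * (ennreal (1 / ?K) * ?N)"
        by (rule mult_left_mono) simp
      also have "\<dots> = ?N"
        using c t by (simp flip: ennreal_mult mult.assoc)
      finally show "ennreal ?K * rearrangement \<nu> d (2 * t) \<le> ?N" .
    qed
  qed
qed

text \<open>If \<open>m\<close> bounds the supremum, the level set at \<open>m / b ^ k\<close> has
  measure at most \<open>2 ^ k * t\<close>. The set for \<open>k = 0\<close> is an admissible
  support, and removing it leaves a remainder bounded by \<open>m\<close>. Its sum in
  \<open>cube_norm_upper\<close> converges because the decay of its values outweighs the doubling of
  the measures.\<close>

lemma approx_error_upper: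
  fixes \<beta> p \<epsilon> :: real
  assumes p: "0 < p" and q: "0 < q" and \<beta>: "\<beta> = 0 \<Longrightarrow> q = ennreal p" and \<epsilon>: "0 < \<epsilon>"
  obtains C where "0 < C"
    "\<And>(u :: 'n::finite dyadic \<Rightarrow> real) a t. (\<And>Q. 0 \<le> u Q) \<Longrightarrow> 0 < t \<Longrightarrow>
       approx_error (\<lambda>b. cube_norm \<beta> p q (\<lambda>Q. u Q * cmod (b Q))) (dyadic_measure (\<beta> * p + 1)) t a
       \<le> ennreal (C * t powr (1 / p)) * (SUP k. ennreal ((2 powr (\<epsilon> + 1 / p)) ^ k)
           * rearrangement (dyadic_measure (\<beta> * p + 1)) (\<lambda>Q. of_real (u Q) * a Q) (2 ^ k * t))"
proof -
  \<comment> \<open>\<open>\<delta>\<close> is chosen so that \<open>(\<epsilon> + 1/p)(1 - \<delta>)p = 1 + \<epsilon>p/2 > 1\<close>, which makes the sum over levels converge.\<close>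
  define \<delta> where "\<delta> = \<epsilon> * p / (2 * (1 + \<epsilon> * p))"
  have ep: "0 < \<epsilon> * p" using p \<epsilon> by simp
  then have \<delta>: "0 < \<delta>" "\<delta> < 1" by (simp_all add: \<delta>_def divide_simps)
  define b where "b = 2 powr (\<epsilon> + 1 / p)"
  have b: "1 < b" using p \<epsilon> by (simp add: b_def add_pos_pos)
  define p' where "p' = (1 - \<delta>) * p"
  have p': "0 < p'" using p \<delta> by (simp add: p'_def)
  \<comment> \<open>From one level to the next the measure bound doubles while the bound for
    \<open>w powr p'\<close> shrinks by \<open>b powr (- p')\<close>.\<close>
  define r where "r = 2 * b powr (- p')"
  have "(\<epsilon> + 1 / p) * p' = 1 + \<epsilon> * p / 2"
  proof -
    have "(\<epsilon> + 1 / p) * p' = (1 + \<epsilon> * p) * (1 - \<delta>)" using p by (simp add: p'_def field_simps)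
    also have "\<dots> = 1 + \<epsilon> * p / 2" using ep by (simp add: \<delta>_def field_simps)
    finally show ?thesis .
  qed
  then have "r = 2 powr 1 * 2 powr (- (1 + \<epsilon> * p / 2))"
    by (simp add: r_def b_def powr_powr)
  also have "\<dots> = 2 powr (1 + - (1 + \<epsilon> * p / 2))" by (simp only: powr_add)
  also have "\<dots> = 2 powr (- (\<epsilon> * p / 2))" by simp
  finally have r: "0 < r" "r < 1" using ep by (simp_all add: powr_less_one)
  define \<nu> :: "'n dyadic measure" where "\<nu> = dyadic_measure (\<beta> * p + 1)"
  show ?thesis
  proof (rule cube_norm_upper[OF p q \<beta> \<delta>, where 'n = 'n])
    fix C :: real
    assume C: "0 < C" and upper: "\<And>(w :: 'n dyadic \<Rightarrow> real) M I. 0 < M \<Longrightarrow> 0 \<le> I \<Longrightarrow> (\<And>Q. 0 \<le> w Q) \<Longrightarrow> (\<And>Q. w Q \<le> M) \<Longrightarrow>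
       (\<integral>\<^sup>+ Q. ennreal (w Q powr ((1 - \<delta>) * p) * vol Q powr (\<beta> * p + 1)) \<partial>count_space UNIV) \<le> ennreal I \<Longrightarrow>
       cube_norm \<beta> p q w \<le> ennreal (C * M powr \<delta> * I powr (1 / p))"
    define C' where "C' = C * (2 / (1 - r)) powr (1 / p)"
    have C': "0 < C'" using C r by (simp add: C'_def)
    show ?thesis
    proof (rule that, unfold \<nu>_def[symmetric] b_def[symmetric])
      show "0 < C'" by (rule C')
      fix u :: "'n dyadic \<Rightarrow> real" and a :: "'n dyadic_seq" and t :: real
      assume u: "\<And>Q. 0 \<le> u Q" and t: "0 < t"
      define d where "d = (\<lambda>Q. of_real (u Q) * a Q)"
      have d: "cmod (d Q) = u Q * cmod (a Q)" for Q
        using u[of Q] by (simp add: d_def norm_mult)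
      let ?N = "\<lambda>b. cube_norm \<beta> p q (\<lambda>Q. u Q * cmod (b Q))"
      let ?K = "C' * t powr (1 / p)"
      have K: "0 < ?K" using C' t by simp
      have bound: "approx_error ?N \<nu> t a \<le> ennreal (?K * m)"
        if m: "0 < m" and rearr: "\<And>k. rearrangement \<nu> d (2 ^ k * t) \<le> ennreal (m / b ^ k)" for m
      proof -
        have level: "emeasure \<nu> {Q. cmod (d Q) > m / b ^ k} \<le> ennreal (2 ^ k * t)" for k
          using m b rearr[of k] by (intro emeasure_le_of_rearrangement_le) (simp_all add: \<nu>_def)
        define \<Gamma> where "\<Gamma> = {Q. cmod (d Q) > m}"
        define w where "w Q = (if Q \<in> \<Gamma> then 0 else cmod (d Q))" for Q
        have w: "0 \<le> w Q" "w Q \<le> m" "w Q \<le> cmod (d Q)" for Q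
          using m by (auto simp: w_def \<Gamma>_def)
        have "\<exists>K. \<forall>Q. 0 < w Q \<longrightarrow> m / b ^ Suc (K Q) < w Q \<and> w Q \<le> m / b ^ K Q"
          by (rule geometric_levels) (simp_all add: b w)
        then obtain K where K: "\<forall>Q. 0 < w Q \<longrightarrow> m / b ^ Suc (K Q) < w Q \<and> w Q \<le> m / b ^ K Q" ..
        let ?F = "\<lambda>Q. ennreal (w Q powr p' * vol Q powr (\<beta> * p + 1))"
        have "(\<integral>\<^sup>+ Q. ?F Q \<partial>count_space UNIV) \<le> ennreal (m powr p' * (2 * t) / (1 - r))"
        proof (rule nn_integral_le_geometric[where K = K])
          fix k
          \<comment> \<open>Cubes on level \<open>k\<close> are only known to exceed the threshold
            for \<open>Suc k\<close>; this shift is the source of the factor 2 in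
            \<open>C'\<close>.\<close>
          let ?E = "{Q. cmod (d Q) > m / b ^ Suc k}"
          have "(\<integral>\<^sup>+ Q. ?F Q * indicator {Q. K Q = k} Q \<partial>count_space UNIV)
            \<le> (\<integral>\<^sup>+ Q. ennreal ((m / b ^ k) powr p') * (ennreal (vol Q powr (\<beta> * p + 1)) * indicator ?E Q) \<partial>count_space UNIV)"
          proof (rule nn_integral_mono)
            fix Q :: "'n dyadic"
            show "?F Q * indicator {Q. K Q = k} Q
              \<le> ennreal ((m / b ^ k) powr p') * (ennreal (vol Q powr (\<beta> * p + 1)) * indicator ?E Q)"
            proof (cases "K Q = k \<and> 0 < w Q")
              case True
              then have *: "m / b ^ Suc k < w Q" "w Q \<le> m / b ^ k" using K by blast+
              then have "Q \<in> ?E" using w(3)[of Q] by simp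
              moreover have "w Q powr p' \<le> (m / b ^ k) powr p'"
                using * w p' by (intro powr_mono2) simp_all
              then have "w Q powr p' * vol Q powr (\<beta> * p + 1) \<le> (m / b ^ k) powr p' * vol Q powr (\<beta> * p + 1)"
                by (rule mult_right_mono) simp
              ultimately show ?thesis
                using True by (simp add: ennreal_leI flip: ennreal_mult)
            next
              case False
              then have "K Q \<noteq> k \<or> w Q = 0" using w(1)[of Q] by linarith
              then show ?thesis by auto
            qed
          qed
          also have "\<dots> = ennreal ((m / b ^ k) powr p') * emeasure \<nu> ?E"
            unfolding \<nu>_def emeasure_dyadic_measure by (rule nn_integral_cmult) simp
          also have "\<dots> \<le> ennreal ((m / b ^ k) powr p') * ennreal (2 ^ Suc k * t)"
            by (intro mult_left_mono level) simp
          also have "\<dots> = ennreal ((m / b ^ k) powr p' * (2 ^ Suc k * t))"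
            using t by (simp add: ennreal_mult)
          also have "(m / b ^ k) powr p' * (2 ^ Suc k * t) = m powr p' * (2 * t) * r ^ k"
          proof -
            have "m / b ^ k = m * b powr (- real k)"
              using b by (simp add: powr_minus powr_realpow divide_inverse)
            then have "(m / b ^ k) powr p' = m powr p' * b powr (- real k * p')"
              by (simp only: powr_mult powr_powr)
            also have "b powr (- real k * p') = (b powr (- p')) ^ k"
              using b by (simp add: powr_power)
            finally show ?thesis by (simp add: r_def power_mult_distrib)
          qed
          finally show "(\<integral>\<^sup>+ Q. ?F Q * indicator {Q. K Q = k} Q \<partial>count_space UNIV)
            \<le> ennreal (m powr p' * (2 * t) * r ^ k)" .
        qed (use r t in simp_all)
        then have "cube_norm \<beta> p q w \<le> ennreal (C * m powr \<delta> * (m powr p' * (2 * t) / (1 - r)) powr (1 / p))"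
          using r t m w by (intro upper) (simp_all add: p'_def)
        \<comment> \<open>The exponents of \<open>m\<close> are \<open>\<delta>\<close> and
          \<open>p' / p = 1 - \<delta>\<close>, so the bound is linear in \<open>m\<close>.\<close>
        also have "C * m powr \<delta> * (m powr p' * (2 * t) / (1 - r)) powr (1 / p) = ?K * m"
        proof -
          have "m powr p' * (2 * t) / (1 - r) = m powr p' * (2 / (1 - r)) * t" by simp
          then have "(m powr p' * (2 * t) / (1 - r)) powr (1 / p)
              = m powr (p' * (1 / p)) * (2 / (1 - r)) powr (1 / p) * t powr (1 / p)"
            by (simp only: powr_mult powr_powr)
          moreover have "m powr \<delta> * m powr (p' * (1 / p)) = m"
            using p m by (simp add: p'_def flip: powr_add)
          ultimately show ?thesis by (simp add: C'_def)
        qed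
        finally have "cube_norm \<beta> p q w \<le> ennreal (?K * m)" .
        moreover have "approx_error ?N \<nu> t a \<le> ?N (\<lambda>Q. a Q - (if Q \<in> \<Gamma> then a Q else 0))"
          unfolding approx_error_def
        proof (rule INF_lower)
          show "(\<lambda>Q. if Q \<in> \<Gamma> then a Q else 0) \<in> Sigma_set \<nu> t"
            unfolding Sigma_set_def
            using level[of 0] by (intro CollectI exI[of _ \<Gamma>] exI[of _ a]) (simp add: \<Gamma>_def)
        qed
        moreover have "(\<lambda>Q. u Q * cmod (a Q - (if Q \<in> \<Gamma> then a Q else 0))) = w"
          by (simp add: w_def d fun_eq_iff)
        ultimately show ?thesis by simp
      qed
      let ?S = "SUP k. ennreal (b ^ k) * rearrangement \<nu> d (2 ^ k * t)"
      show "approx_error ?N \<nu> t a \<le> ennreal ?K * ?S"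
      proof (cases ?S)
        case top
        have "ennreal ?K * top = top" using C' t by (simp add: ennreal_mult_top)
        then show ?thesis unfolding top by simp
      next
        case (real s)
        have "approx_error ?N \<nu> t a \<le> ennreal (?K * s) + ennreal e" if e: "0 < e" for e
        proof -
          \<comment> \<open>The slack \<open>e\<close> covers the case \<open>s = 0\<close>, since \<open>bound\<close> needs \<open>0 < m\<close>.\<close>
          define m where "m = s + e / ?K"
          have m: "0 < m" "s \<le> m" using K e real by (simp_all add: m_def add_nonneg_pos)
          have "rearrangement \<nu> d (2 ^ k * t) \<le> ennreal (m / b ^ k)" for k
          proof -
            have "ennreal (b ^ k) * rearrangement \<nu> d (2 ^ k * t) \<le> ?S"
              by (rule SUP_upper) simp
            also have "?S \<le> ennreal m" using real m by (simp add: ennreal_leI)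
            finally have le: "ennreal (b ^ k) * rearrangement \<nu> d (2 ^ k * t) \<le> ennreal m" .
            have "rearrangement \<nu> d (2 ^ k * t) = ennreal (1 / b ^ k) * (ennreal (b ^ k) * rearrangement \<nu> d (2 ^ k * t))"
              using b by (simp flip: ennreal_mult mult.assoc)
            also have "\<dots> \<le> ennreal (1 / b ^ k) * ennreal m"
              by (intro mult_left_mono le) simp
            also have "\<dots> = ennreal (m / b ^ k)"
              using b m by (simp flip: ennreal_mult)
            finally show ?thesis .
          qed
          then have "approx_error ?N \<nu> t a \<le> ennreal (?K * m)" by (intro bound m)
          also have "?K * m = ?K * s + e" using C' t by (simp add: m_def distrib_left)
          also have "ennreal (?K * s + e) = ennreal (?K * s) + ennreal e"
            using K real e by (intro ennreal_plus) simp_all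
          finally show ?thesis .
        qed
        then have "approx_error ?N \<nu> t a \<le> ennreal (?K * s)"
          by (rule ennreal_le_epsilon)
        also have "ennreal (?K * s) = ennreal ?K * ?S"
          unfolding real(2) using K real(1) by (intro ennreal_mult) simp_all
        finally show ?thesis .
      qed
    qed
  qed
qed

section \<open>The weighted functional and the equivalence\<close>

text \<open>Superlevel sets of a nonincreasing function are intervals. This supplies measurability
  of the rearrangement.\<close>

lemma borel_measurable_antimono_ennreal:
  fixes \<phi> :: "real \<Rightarrow> ennreal"
  assumes "\<And>s t. s \<le> t \<Longrightarrow> \<phi> t \<le> \<phi> s"
  shows "\<phi> \<in> borel_measurable borel"
proof (rule borel_measurableI_greater)
  fix y
  have "is_interval {t. y < \<phi> t}"
    unfolding is_interval_1 using assms by (blast intro: less_le_trans)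
  then show "{t \<in> space borel. y < \<phi> t} \<in> sets borel"
    by (simp add: real_interval_borel_measurable)
qed

text \<open>Two different weights allow a factor \<open>t powr (1 / p)\<close> to move between
  weight and function. Monotonicity of the integral holds for arbitrary functions, so the
  approximation error may appear on either side.\<close>

lemma weighted_norm_mono:
  assumes "\<And>t. 0 < t \<Longrightarrow> ennreal (t powr \<kappa>) * \<phi> t \<le> ennreal (t powr \<kappa>') * \<psi> t"
  shows "weighted_norm \<kappa> \<mu> \<phi> \<le> weighted_norm \<kappa>' \<mu> \<psi>"
proof (cases "\<mu> = \<infinity>")
  case True
  have "(SUP t\<in>{0<..}. ennreal (t powr \<kappa>) * \<phi> t) \<le> (SUP t\<in>{0<..}. ennreal (t powr \<kappa>') * \<psi> t)"
    using assms by (intro SUP_mono) auto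
  then show ?thesis using True by (simp add: weighted_norm_def)
next
  case False
  have "(\<integral>\<^sup>+ t\<in>{0<..}. epowr (ennreal (t powr \<kappa>) * \<phi> t) (enn2real \<mu>) * ennreal (1 / t) \<partial>lborel)
     \<le> (\<integral>\<^sup>+ t\<in>{0<..}. epowr (ennreal (t powr \<kappa>') * \<psi> t) (enn2real \<mu>) * ennreal (1 / t) \<partial>lborel)"
  proof (rule nn_integral_mono)
    fix t :: real
    show "epowr (ennreal (t powr \<kappa>) * \<phi> t) (enn2real \<mu>) * ennreal (1 / t) * indicator {0<..} t
      \<le> epowr (ennreal (t powr \<kappa>') * \<psi> t) (enn2real \<mu>) * ennreal (1 / t) * indicator {0<..} t"
    proof (cases "0 < t")
      case True
      then show ?thesis
        using assms[OF True] by (intro mult_right_mono epowr_mono) simp_all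
    qed simp
  qed
  then show ?thesis using False by (simp add: weighted_norm_def recip_def epowr_mono)
qed

text \<open>The substitution of \<open>s * t\<close> for \<open>t\<close> preserves
  \<open>dt / t\<close>, and the factor \<open>s powr \<kappa>\<close> completes the weight to
  \<open>(s * t) powr \<kappa>\<close>.\<close>

lemma weighted_norm_dilate:
  assumes [measurable]: "\<phi> \<in> borel_measurable borel" and s: "0 < s"
  shows "weighted_norm \<kappa> \<mu> (\<lambda>t. ennreal (s powr \<kappa>) * \<phi> (s * t)) = weighted_norm \<kappa> \<mu> \<phi>"
proof -
  have dil: "ennreal (t powr \<kappa>) * (ennreal (s powr \<kappa>) * \<phi> (s * t)) = ennreal ((s * t) powr \<kappa>) * \<phi> (s * t)" for t
    by (simp add: powr_mult ennreal_mult mult_ac)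
  show ?thesis
  proof (cases "\<mu> = \<infinity>")
    case True
    have "(SUP t\<in>{0<..}. ennreal ((s * t) powr \<kappa>) * \<phi> (s * t))
        = (SUP t\<in>(*) s ` {0<..}. ennreal (t powr \<kappa>) * \<phi> t)"
      by (simp add: image_image)
    also have "(*) s ` {0<..} = {0<..}"
    proof (intro equalityI subsetI)
      fix t :: real assume "t \<in> {0<..}"
      then show "t \<in> (*) s ` {0<..}" using s by (intro image_eqI[of _ _ "t / s"]) auto
    qed (use s in auto)
    finally show ?thesis using True by (simp add: weighted_norm_def dil)
  next
    case False
    define G where "G t = epowr (ennreal (t powr \<kappa>) * \<phi> t) (enn2real \<mu>) * ennreal (1 / t) * indicator {0<..} t" for t
    have [measurable]: "G \<in> borel_measurable borel" unfolding G_def by measurable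
    have "(\<integral>\<^sup>+ t. G t \<partial>lborel) = ennreal s * (\<integral>\<^sup>+ t. G (0 + s * t) \<partial>lborel)"
      using nn_integral_real_affine[of G s 0] s by simp
    also have "\<dots> = (\<integral>\<^sup>+ t. ennreal s * G (0 + s * t) \<partial>lborel)"
      by (rule nn_integral_cmult[symmetric]) measurable
    also have "\<dots> = (\<integral>\<^sup>+ t\<in>{0<..}. epowr (ennreal ((s * t) powr \<kappa>) * \<phi> (s * t)) (enn2real \<mu>) * ennreal (1 / t) \<partial>lborel)"
    proof (rule nn_integral_cong)
      fix t :: real
      \<comment> \<open>The Jacobian of the affine substitution cancels the \<open>s\<close> in
        \<open>1 / (s * t)\<close>.\<close>
      have "ennreal s * (x * ennreal (1 / (s * t))) = x * ennreal (1 / t)" if "0 < t" for x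
        using s that by (subst mult.left_commute) (simp flip: ennreal_mult)
      then show "ennreal s * G (0 + s * t)
          = epowr (ennreal ((s * t) powr \<kappa>) * \<phi> (s * t)) (enn2real \<mu>) * ennreal (1 / t) * indicator {0<..} t"
        using s by (simp add: G_def zero_less_mult_iff split: split_indicator)
    qed
    finally show ?thesis using False by (simp add: weighted_norm_def dil G_def)
  qed
qed

lemma weighted_norm_cmult:
  assumes [measurable]: "\<phi> \<in> borel_measurable borel" and c: "0 \<le> c" and \<mu>: "0 < \<mu>"
  shows "weighted_norm \<kappa> \<mu> (\<lambda>t. ennreal c * \<phi> t) = ennreal c * weighted_norm \<kappa> \<mu> \<phi>"
  using \<mu>
proof (cases \<mu> rule: ennreal_exponent_cases)
  case top
  then show ?thesis
    by (simp add: weighted_norm_def SUP_mult_left_ennreal mult.left_commute)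
next
  case (real m)
  have "(\<integral>\<^sup>+ t\<in>{0<..}. epowr (ennreal (t powr \<kappa>) * (ennreal c * \<phi> t)) m * ennreal (1 / t) \<partial>lborel)
    = (\<integral>\<^sup>+ t. ennreal (c powr m) * (epowr (ennreal (t powr \<kappa>) * \<phi> t) m * ennreal (1 / t) * indicator {0<..} t) \<partial>lborel)"
    using c by (intro nn_integral_cong) (simp add: epowr_mult mult_ac)
  also have "\<dots> = ennreal (c powr m) * (\<integral>\<^sup>+ t\<in>{0<..}. epowr (ennreal (t powr \<kappa>) * \<phi> t) m * ennreal (1 / t) \<partial>lborel)"
    by (rule nn_integral_cmult) measurable
  finally show ?thesis
    using real c by (simp add: weighted_norm_def recip_ennreal epowr_mult powr_powr)
qed

text \<open>For finite \<open>\<mu>\<close> the \<open>\<mu>\<close>-th power of a supremum is at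
  most the sum of the \<open>\<mu>\<close>-th powers, which is integrated termwise. This avoids the
  triangle inequality, which fails for \<open>\<mu> < 1\<close>; the powers of \<open>\<rho>\<close>
  make the series converge.\<close>

lemma weighted_norm_SUP_le:
  assumes \<mu>: "0 < \<mu>" and \<rho>: "0 < \<rho>" "\<rho> < 1"
  obtains C where "0 < C"
    "\<And>\<phi> N. (\<And>k. \<phi> k \<in> borel_measurable borel) \<Longrightarrow> (\<And>k. weighted_norm \<kappa> \<mu> (\<phi> k) \<le> N) \<Longrightarrow>
      weighted_norm \<kappa> \<mu> (\<lambda>t. SUP k. ennreal (\<rho> ^ k) * \<phi> k t) \<le> ennreal C * N"
  using \<mu>
proof (cases \<mu> rule: ennreal_exponent_cases)
  case top
  show thesis
  proof
    fix \<phi> :: "nat \<Rightarrow> real \<Rightarrow> ennreal" and N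
    assume le: "\<And>k. weighted_norm \<kappa> \<mu> (\<phi> k) \<le> N"
    have "ennreal (t powr \<kappa>) * (SUP k. ennreal (\<rho> ^ k) * \<phi> k t) \<le> N" if t: "0 < t" for t
      unfolding SUP_mult_left_ennreal
    proof (rule SUP_least)
      fix k
      have "ennreal (\<rho> ^ k) \<le> ennreal 1" using \<rho> by (intro ennreal_leI power_le_one) simp_all
      then have "ennreal (\<rho> ^ k) * (ennreal (t powr \<kappa>) * \<phi> k t) \<le> ennreal (t powr \<kappa>) * \<phi> k t"
        using mult_right_mono[of "ennreal (\<rho> ^ k)" "ennreal 1" "ennreal (t powr \<kappa>) * \<phi> k t"] by simp
      also have "\<dots> \<le> (SUP t\<in>{0<..}. ennreal (t powr \<kappa>) * \<phi> k t)"
        using t by (intro SUP_upper) simp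
      also have "\<dots> \<le> N" using le[of k] top by (simp add: weighted_norm_def)
      finally show "ennreal (t powr \<kappa>) * (ennreal (\<rho> ^ k) * \<phi> k t) \<le> N"
        by (simp add: mult.left_commute)
    qed
    then show "weighted_norm \<kappa> \<mu> (\<lambda>t. SUP k. ennreal (\<rho> ^ k) * \<phi> k t) \<le> ennreal 1 * N"
      using top by (auto simp: weighted_norm_def intro: SUP_least)
  qed simp
next
  case (real m)
  define r where "r = \<rho> powr m"
  have r: "0 < r" "r < 1" using \<rho> real powr_less_mono2[of m \<rho> 1] by (simp_all add: r_def)
  show thesis
  proof
    show "0 < (1 / (1 - r)) powr (1 / m)" using r by simp
    fix \<phi> :: "nat \<Rightarrow> real \<Rightarrow> ennreal" and N
    assume [measurable]: "\<And>k. \<phi> k \<in> borel_measurable borel"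
      and le: "\<And>k. weighted_norm \<kappa> \<mu> (\<phi> k) \<le> N"
    define g where "g k t = epowr (ennreal (t powr \<kappa>) * \<phi> k t) m" for k t
    have [measurable]: "g k \<in> borel_measurable borel" for k unfolding g_def by measurable
    have int: "(\<integral>\<^sup>+ t\<in>{0<..}. g k t * ennreal (1 / t) \<partial>lborel) \<le> epowr N m" for k
    proof -
      have "epowr (epowr (\<integral>\<^sup>+ t\<in>{0<..}. g k t * ennreal (1 / t) \<partial>lborel) (1 / m)) m \<le> epowr N m"
        using le[of k] real by (intro epowr_mono) (simp_all add: weighted_norm_def recip_ennreal g_def)
      then show ?thesis using real by (simp add: epowr_epowr)
    qed
    \<comment> \<open>After taking \<open>m\<close>-th roots the supremum can be bounded term by
      term against the root of the full series.\<close>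
    have pw: "epowr (ennreal (t powr \<kappa>) * (SUP k. ennreal (\<rho> ^ k) * \<phi> k t)) m \<le> (\<Sum>k. ennreal (r ^ k) * g k t)" for t
    proof -
      let ?S = "\<Sum>k. ennreal (r ^ k) * g k t"
      have "ennreal (t powr \<kappa>) * (SUP k. ennreal (\<rho> ^ k) * \<phi> k t) \<le> epowr ?S (1 / m)"
        unfolding SUP_mult_left_ennreal
      proof (rule SUP_least)
        fix k
        have "(\<rho> ^ k) powr m = r ^ k"
          using \<rho> by (simp add: r_def powr_power powr_powr mult.commute flip: powr_realpow)
        then have "epowr (ennreal (t powr \<kappa>) * (ennreal (\<rho> ^ k) * \<phi> k t)) m = ennreal (r ^ k) * g k t"
          using \<rho> by (simp add: g_def epowr_mult mult_ac)
        also have "\<dots> \<le> ?S"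
          using sum_le_suminf[of "\<lambda>k. ennreal (r ^ k) * g k t" "{k}"] by simp
        finally have "epowr (epowr (ennreal (t powr \<kappa>) * (ennreal (\<rho> ^ k) * \<phi> k t)) m) (1 / m) \<le> epowr ?S (1 / m)"
          using real by (intro epowr_mono) simp_all
        then show "ennreal (t powr \<kappa>) * (ennreal (\<rho> ^ k) * \<phi> k t) \<le> epowr ?S (1 / m)"
          using real by (simp add: epowr_epowr)
      qed
      then have "epowr (ennreal (t powr \<kappa>) * (SUP k. ennreal (\<rho> ^ k) * \<phi> k t)) m \<le> epowr (epowr ?S (1 / m)) m"
        using real by (intro epowr_mono) simp_all
      then show ?thesis using real by (simp add: epowr_epowr)
    qed
    have "(\<integral>\<^sup>+ t\<in>{0<..}. epowr (ennreal (t powr \<kappa>) * (SUP k. ennreal (\<rho> ^ k) * \<phi> k t)) m * ennreal (1 / t) \<partial>lborel)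
        \<le> (\<integral>\<^sup>+ t. (\<Sum>k. ennreal (r ^ k) * (g k t * ennreal (1 / t) * indicator {0<..} t)) \<partial>lborel)"
    proof (rule nn_integral_mono)
      fix t
      have "epowr (ennreal (t powr \<kappa>) * (SUP k. ennreal (\<rho> ^ k) * \<phi> k t)) m * (ennreal (1 / t) * indicator {0<..} t)
          \<le> (\<Sum>k. ennreal (r ^ k) * g k t) * (ennreal (1 / t) * indicator {0<..} t)"
        by (intro mult_right_mono pw) simp
      also have "\<dots> = (\<Sum>k. ennreal (r ^ k) * g k t * (ennreal (1 / t) * indicator {0<..} t))"
        by (rule ennreal_suminf_multc[symmetric])
      finally show "epowr (ennreal (t powr \<kappa>) * (SUP k. ennreal (\<rho> ^ k) * \<phi> k t)) m * ennreal (1 / t) * indicator {0<..} t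
          \<le> (\<Sum>k. ennreal (r ^ k) * (g k t * ennreal (1 / t) * indicator {0<..} t))"
        by (simp only: mult.assoc)
    qed
    also have "\<dots> = (\<Sum>k. \<integral>\<^sup>+ t. ennreal (r ^ k) * (g k t * ennreal (1 / t) * indicator {0<..} t) \<partial>lborel)"
      by (rule nn_integral_suminf) measurable
    also have "\<dots> = (\<Sum>k. ennreal (r ^ k) * (\<integral>\<^sup>+ t\<in>{0<..}. g k t * ennreal (1 / t) \<partial>lborel))"
      by (intro suminf_cong nn_integral_cmult) measurable
    also have "\<dots> \<le> (\<Sum>k. ennreal (r ^ k) * epowr N m)"
      by (intro suminf_le mult_left_mono int) auto
    also have "\<dots> = (\<Sum>k. ennreal (r ^ k)) * epowr N m"
      by (rule ennreal_suminf_multc)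
    also have "(\<Sum>k. ennreal (r ^ k)) = ennreal (1 / (1 - r))"
      using r by (intro suminf_ennreal_eq geometric_sums) simp_all
    finally have "epowr (\<integral>\<^sup>+ t\<in>{0<..}. epowr (ennreal (t powr \<kappa>) * (SUP k. ennreal (\<rho> ^ k) * \<phi> k t)) m * ennreal (1 / t) \<partial>lborel) (1 / m)
        \<le> epowr (ennreal (1 / (1 - r)) * epowr N m) (1 / m)"
      using real by (intro epowr_mono) simp_all
    also have "\<dots> = epowr (ennreal (1 / (1 - r))) (1 / m) * N"
      using real by (simp add: epowr_mult epowr_epowr)
    also have "epowr (ennreal (1 / (1 - r))) (1 / m) = ennreal ((1 / (1 - r)) powr (1 / m))"
      using r by (intro epowr_ennreal) simp
    finally show "weighted_norm \<kappa> \<mu> (\<lambda>t. SUP k. ennreal (\<rho> ^ k) * \<phi> k t) \<le> ennreal ((1 / (1 - r)) powr (1 / m)) * N"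
      using real by (simp add: weighted_norm_def recip_ennreal)
  qed
qed

section \<open>Equivalence of the approximation and Lorentz quasi-norms\<close>

theorem corollary2p10p3:
  fixes s1 s2 p1 p2 \<alpha> \<xi> \<tau> :: real
    and q1 q2 \<mu> :: ennreal
    and \<nu> :: "'n::finite dyadic measure"
  assumes "0 < p1" and "0 < p2" and "0 < q1" and "0 < q2"
    and "\<alpha> = p1 * ((s2 - s1) / real CARD('n) - 1 / p2) + 1"
    and "\<nu> = dyadic_measure \<alpha>"
    and "0 < \<xi>" and "0 < \<mu>"
    and "1 / \<tau> = \<xi> + 1 / p1"
    and "\<alpha> = 1 \<Longrightarrow> q1 = ennreal p1"
  shows "approx_space (f_norm s1 p1 q1) \<nu> \<xi> \<mu> = lorentz_space \<tau> \<mu> (unit_weight s2 p2 q2) \<nu> \<and>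
    equivalent_on (approx_space (f_norm s1 p1 q1) \<nu> \<xi> \<mu>)
      (approx_norm (f_norm s1 p1 q1) \<nu> \<xi> \<mu>)
      (lorentz_norm \<tau> \<mu> (unit_weight s2 p2 q2) \<nu>)"
proof -
  define \<beta> where "\<beta> = (s2 - s1) / real CARD('n) - 1 / p2"
  have \<alpha>: "\<alpha> = \<beta> * p1 + 1" using assms(5) by (simp add: \<beta>_def)
  \<comment> \<open>Vanishing \<open>\<beta>\<close> means \<open>\<alpha> = 1\<close>, the case in
    which equality of the exponents is assumed.\<close>
  have \<beta>: "q1 = ennreal p1" if "\<beta> = 0" using assms(10) \<alpha> that by simp
  define u :: "'n dyadic \<Rightarrow> real" where "u = unit_weight s2 p2 q2"
  have u: "0 \<le> u Q" for Q by (simp add: u_def unit_weight_def)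
  have N_eq: "f_norm s1 p1 q1 = (\<lambda>b. cube_norm \<beta> p1 q1 (\<lambda>Q. u Q * cmod (b Q)))"
    unfolding u_def using assms by (intro ext f_norm_eq_cube_norm) (simp_all add: \<beta>_def)
  define \<kappa> where "\<kappa> = \<xi> + 1 / p1"
  define \<phi> where "\<phi> a = rearrangement \<nu> (\<lambda>Q. of_real (u Q) * a Q)" for a
  have [measurable]: "\<phi> a \<in> borel_measurable borel" for a
    unfolding \<phi>_def by (intro borel_measurable_antimono_ennreal rearrangement_antimono)
  have lorentz: "lorentz_norm \<tau> \<mu> u \<nu> a = weighted_norm \<kappa> \<mu> (\<phi> a)" for a
    using assms(9) by (simp add: lorentz_norm_def \<phi>_def \<kappa>_def)
  define \<psi> where "\<psi> = (\<lambda>a t. approx_error (f_norm s1 p1 q1) \<nu> t a)"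
  have approx: "approx_norm (f_norm s1 p1 q1) \<nu> \<xi> \<mu> a = weighted_norm \<xi> \<mu> (\<psi> a)" for a
    by (simp add: approx_norm_def \<psi>_def)

  \<comment> \<open>The Lorentz quasi-norm is controlled by the approximation quasi-norm\<close>
  have "\<exists>c>0. \<forall>a. ennreal c * weighted_norm \<kappa> \<mu> (\<phi> a) \<le> weighted_norm \<xi> \<mu> (\<psi> a)"
  proof (rule approx_error_lower[OF assms(1,3) \<beta>, where 'n = 'n])
    fix c :: real
    assume c: "0 < c" and "\<And>(u :: 'n dyadic \<Rightarrow> real) a t. (\<And>Q. 0 \<le> u Q) \<Longrightarrow> 0 < t \<Longrightarrow>
       ennreal (c * t powr (1 / p1)) * rearrangement (dyadic_measure (\<beta> * p1 + 1)) (\<lambda>Q. of_real (u Q) * a Q) (2 * t)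
       \<le> approx_error (\<lambda>b. cube_norm \<beta> p1 q1 (\<lambda>Q. u Q * cmod (b Q))) (dyadic_measure (\<beta> * p1 + 1)) t a"
    from this(2)[OF u] have lower: "ennreal (c * t powr (1 / p1)) * \<phi> a (2 * t) \<le> \<psi> a t" if "0 < t" for a t
      using that unfolding \<phi>_def \<psi>_def N_eq assms(6) \<alpha> .
    \<comment> \<open>The factor \<open>2 powr (- \<kappa>)\<close> is the price of the dilation by
      2 that brings \<open>2 * t\<close> back to \<open>t\<close>.\<close>
    define c' where "c' = c * 2 powr (- \<kappa>)"
    have c': "0 < c'" using c by (simp add: c'_def)
    have "ennreal c' * weighted_norm \<kappa> \<mu> (\<phi> a) \<le> weighted_norm \<xi> \<mu> (\<psi> a)" for a
    proof -
      have "ennreal c' * weighted_norm \<kappa> \<mu> (\<phi> a)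
          = weighted_norm \<kappa> \<mu> (\<lambda>t. ennreal c' * (ennreal (2 powr \<kappa>) * \<phi> a (2 * t)))"
        using c' assms(8) weighted_norm_dilate[of "\<phi> a" 2 \<kappa> \<mu>] by (subst weighted_norm_cmult) simp_all
      also have "\<dots> \<le> weighted_norm \<xi> \<mu> (\<psi> a)"
      proof (rule weighted_norm_mono)
        fix t :: real assume t: "0 < t"
        have "t powr \<kappa> * c' * 2 powr \<kappa> = t powr \<xi> * (c * t powr (1 / p1))"
        proof -
          have "c' * 2 powr \<kappa> = c" by (simp add: c'_def flip: powr_add)
          then show ?thesis by (simp add: \<kappa>_def powr_add)
        qed
        then have "ennreal (t powr \<kappa>) * (ennreal c' * (ennreal (2 powr \<kappa>) * \<phi> a (2 * t)))
            = ennreal (t powr \<xi>) * (ennreal (c * t powr (1 / p1)) * \<phi> a (2 * t))"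
          using c c' by (simp flip: ennreal_mult mult.assoc)
        also have "\<dots> \<le> ennreal (t powr \<xi>) * \<psi> a t"
          by (intro mult_left_mono lower t) simp
        finally show "ennreal (t powr \<kappa>) * (ennreal c' * (ennreal (2 powr \<kappa>) * \<phi> a (2 * t))) \<le> \<dots>" .
      qed
      finally show ?thesis .
    qed
    then show ?thesis using c' by blast
  qed
  then obtain c where c: "0 < c" "\<And>a. ennreal c * weighted_norm \<kappa> \<mu> (\<phi> a) \<le> weighted_norm \<xi> \<mu> (\<psi> a)"
    by blast

  \<comment> \<open>The approximation quasi-norm is controlled by the Lorentz quasi-norm\<close>
  have "\<exists>C>0. \<forall>a. weighted_norm \<xi> \<mu> (\<psi> a) \<le> ennreal C * weighted_norm \<kappa> \<mu> (\<phi> a)"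
  proof (rule approx_error_upper[OF assms(1,3) \<beta>, where 'n = 'n and \<epsilon> = "\<xi> / 2"])
    show "0 < \<xi> / 2" using assms(7) by simp
    fix C :: real
    define b where "b = 2 powr (\<xi> / 2 + 1 / p1)"
    assume C: "0 < C" and "\<And>(u :: 'n dyadic \<Rightarrow> real) a t. (\<And>Q. 0 \<le> u Q) \<Longrightarrow> 0 < t \<Longrightarrow>
       approx_error (\<lambda>b. cube_norm \<beta> p1 q1 (\<lambda>Q. u Q * cmod (b Q))) (dyadic_measure (\<beta> * p1 + 1)) t a
       \<le> ennreal (C * t powr (1 / p1)) * (SUP k. ennreal ((2 powr (\<xi> / 2 + 1 / p1)) ^ k)
           * rearrangement (dyadic_measure (\<beta> * p1 + 1)) (\<lambda>Q. of_real (u Q) * a Q) (2 ^ k * t))"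
    from this(2)[OF u] have upper: "\<psi> a t \<le> ennreal (C * t powr (1 / p1)) * (SUP k. ennreal (b ^ k) * \<phi> a (2 ^ k * t))"
      if "0 < t" for a t
      using that unfolding \<phi>_def \<psi>_def N_eq assms(6) \<alpha> b_def .
    \<comment> \<open>This is \<open>b / 2 powr \<kappa>\<close>: the growth \<open>b ^ k\<close>
      falls short of the dilation factor \<open>(2 ^ k) powr \<kappa>\<close> by
      \<open>\<rho> ^ k\<close>, which pays for the supremum over \<open>k\<close>.\<close>
    define \<rho> where "\<rho> = 2 powr (- (\<xi> / 2))"
    have \<rho>: "0 < \<rho>" "\<rho> < 1" using assms(7) by (simp_all add: \<rho>_def powr_less_one)
    have b: "b ^ k = \<rho> ^ k * (2 ^ k) powr \<kappa>" for k
    proof -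
      have "b = \<rho> * 2 powr \<kappa>" by (simp add: b_def \<rho>_def \<kappa>_def flip: powr_add)
      moreover have "(2 powr \<kappa>) ^ k = (2 ^ k) powr \<kappa>"
        by (simp add: powr_power powr_powr mult.commute flip: powr_realpow)
      ultimately show ?thesis by (simp add: power_mult_distrib)
    qed
    \<comment> \<open>The dilates are normalized so that each has the same weighted norm as
      \<open>\<phi> a\<close>, giving one bound for all \<open>k\<close>.\<close>
    define \<Phi> where "\<Phi> a k t = ennreal ((2 ^ k) powr \<kappa>) * \<phi> a (2 ^ k * t)" for a k t
    have [measurable]: "\<Phi> a k \<in> borel_measurable borel" for a k unfolding \<Phi>_def by measurable
    show ?thesis
    proof (rule weighted_norm_SUP_le[OF assms(8) \<rho>, of \<kappa>])
      fix C2 :: real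
      assume C2: "0 < C2" and SUP_le: "\<And>\<phi> N. (\<And>k. \<phi> k \<in> borel_measurable borel) \<Longrightarrow> (\<And>k. weighted_norm \<kappa> \<mu> (\<phi> k) \<le> N) \<Longrightarrow>
        weighted_norm \<kappa> \<mu> (\<lambda>t. SUP k. ennreal (\<rho> ^ k) * \<phi> k t) \<le> ennreal C2 * N"
      have "weighted_norm \<xi> \<mu> (\<psi> a) \<le> ennreal (C * C2) * weighted_norm \<kappa> \<mu> (\<phi> a)" for a
      proof -
        have "weighted_norm \<xi> \<mu> (\<psi> a) \<le> weighted_norm \<kappa> \<mu> (\<lambda>t. ennreal C * (SUP k. ennreal (\<rho> ^ k) * \<Phi> a k t))"
        proof (rule weighted_norm_mono)
          fix t :: real assume t: "0 < t"
          have "ennreal (t powr \<xi>) * \<psi> a t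
              \<le> ennreal (t powr \<xi>) * (ennreal (C * t powr (1 / p1)) * (SUP k. ennreal (b ^ k) * \<phi> a (2 ^ k * t)))"
            by (intro mult_left_mono upper t) simp
          also have "(SUP k. ennreal (b ^ k) * \<phi> a (2 ^ k * t)) = (SUP k. ennreal (\<rho> ^ k) * \<Phi> a k t)"
            using \<rho> by (simp add: b \<Phi>_def ennreal_mult mult.assoc)
          also have "ennreal (t powr \<xi>) * (ennreal (C * t powr (1 / p1)) * \<dots>) = ennreal (t powr \<kappa>) * (ennreal C * \<dots>)"
            using C by (simp add: \<kappa>_def powr_add ennreal_mult mult_ac)
          finally show "ennreal (t powr \<xi>) * \<psi> a t \<le> ennreal (t powr \<kappa>) * (ennreal C * (SUP k. ennreal (\<rho> ^ k) * \<Phi> a k t))" .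
        qed
        also have "\<dots> = ennreal C * weighted_norm \<kappa> \<mu> (\<lambda>t. SUP k. ennreal (\<rho> ^ k) * \<Phi> a k t)"
          using C assms(8) by (intro weighted_norm_cmult) simp_all
        also have "\<dots> \<le> ennreal C * (ennreal C2 * weighted_norm \<kappa> \<mu> (\<phi> a))"
        proof (intro mult_left_mono SUP_le)
          show "weighted_norm \<kappa> \<mu> (\<Phi> a k) \<le> weighted_norm \<kappa> \<mu> (\<phi> a)" for k
            unfolding \<Phi>_def by (simp add: weighted_norm_dilate)
        qed simp_all
        also have "\<dots> = ennreal (C * C2) * weighted_norm \<kappa> \<mu> (\<phi> a)"
          using C C2 by (simp add: ennreal_mult mult.assoc)
        finally show ?thesis .
      qed
      then show ?thesis using C C2 by (intro exI[of _ "C * C2"]) simp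
    qed
  qed
  then obtain C where C: "0 < C" "\<And>a. weighted_norm \<xi> \<mu> (\<psi> a) \<le> ennreal C * weighted_norm \<kappa> \<mu> (\<phi> a)"
    by blast

  \<comment> \<open>Equality of the spaces and the constants of equivalence\<close>
  have cancel: "y \<le> ennreal (1 / e) * x" if "0 < e" "ennreal e * y \<le> x" for e x y
  proof -
    have "y = ennreal (1 / e) * (ennreal e * y)"
      using that(1) by (simp flip: ennreal_mult mult.assoc)
    also have "\<dots> \<le> ennreal (1 / e) * x" by (intro mult_left_mono that(2)) simp
    finally show ?thesis .
  qed
  have upper: "weighted_norm \<kappa> \<mu> (\<phi> a) \<le> ennreal (1 / c) * weighted_norm \<xi> \<mu> (\<psi> a)" for a
    by (rule cancel[OF c])
  have lower: "ennreal (1 / C) * weighted_norm \<xi> \<mu> (\<psi> a) \<le> weighted_norm \<kappa> \<mu> (\<phi> a)" for a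
  proof -
    have "ennreal (1 / C) * weighted_norm \<xi> \<mu> (\<psi> a) \<le> ennreal (1 / C) * (ennreal C * weighted_norm \<kappa> \<mu> (\<phi> a))"
      by (intro mult_left_mono C(2)) simp
    also have "\<dots> = weighted_norm \<kappa> \<mu> (\<phi> a)"
      using C(1) by (simp flip: ennreal_mult mult.assoc)
    finally show ?thesis .
  qed
  \<comment> \<open>Both estimates hold for every sequence, so finiteness passes in both directions
    and the spaces agree as sets.\<close>
  have "weighted_norm \<xi> \<mu> (\<psi> a) < \<infinity> \<longleftrightarrow> weighted_norm \<kappa> \<mu> (\<phi> a) < \<infinity>" for a
  proof
    assume "weighted_norm \<xi> \<mu> (\<psi> a) < \<infinity>"
    then have "ennreal (1 / c) * weighted_norm \<xi> \<mu> (\<psi> a) < \<infinity>" by (simp add: ennreal_mult_less_top)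
    then show "weighted_norm \<kappa> \<mu> (\<phi> a) < \<infinity>" using upper[of a] by order
  next
    assume "weighted_norm \<kappa> \<mu> (\<phi> a) < \<infinity>"
    then have "ennreal C * weighted_norm \<kappa> \<mu> (\<phi> a) < \<infinity>" by (simp add: ennreal_mult_less_top)
    then show "weighted_norm \<xi> \<mu> (\<psi> a) < \<infinity>" using C(2)[of a] by order
  qed
  then have "approx_space (f_norm s1 p1 q1) \<nu> \<xi> \<mu> = lorentz_space \<tau> \<mu> u \<nu>"
    by (simp add: approx_space_def lorentz_space_def lorentz approx)
  moreover have "equivalent_on (approx_space (f_norm s1 p1 q1) \<nu> \<xi> \<mu>)
      (approx_norm (f_norm s1 p1 q1) \<nu> \<xi> \<mu>) (lorentz_norm \<tau> \<mu> u \<nu>)"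
    unfolding equivalent_on_def lorentz approx
    using c(1) C(1) lower upper by (intro exI[of _ "1 / C"] exI[of _ "1 / c"]) simp
  ultimately show ?thesis unfolding u_def by blast
qed

end
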